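(* Assume (A1)–(A5) as listed in the context. Let $k\in D=\{1,\ldots,d\}$, let $x\in X$, and let $f=f_x:\mathbb{R}^d\to\mathbb{R}$, $$f(\xi)=\max_{j=1,\ldots,\ell}\langle v^{j},(\xi,\bar h)-Tx\rangle ,$$ be the integrand of the linear two-stage stochastic program. Then the $k$th projection $$(P_kf)(\xi)=\int_{-\infty}^{\infty}f(\xi_1,\ldots,\xi_{k-1},s,\xi_{k+1},\ldots,\xi_d)\,\rho_k(s)\,ds\qquad(\xi\in\mathbb{R}^d)$$ is continuously differentiable on $\mathbb{R}^d$. Moreover, if $\rho_k\in C^{s-2}(\mathbb{R})$ for some $s\in\mathbb{N}$, $s\ge 2$, then $P_kf$ is $s$-times continuously differentiable almost everywhere on $\mathbb{R}^d$.
   Context: Setting. $X\subseteq\mathbb{R}^m$ is a convex polyhedral set, $T$ is a real $r\times m$ matrix, $W$ a real $r\times\bar m$ matrix, $q\in\mathbb{R}^{\bar m}$, $d\le r$, and $h(\xi)=(\xi,\bar h)\in\mathbb{R}^r$ for $\xi\in\mathbb{R}^d$, with a fixed $\bar h\in\mathbb{R}^{r-d}$. $P$ is a probability distribution on $\mathbb{R}^d$. The two-stage stochastic program is $\min\{\langle c,x\rangle+\int_{\mathbb{R}^d}\Phi(x,\xi)P(d\xi):x\in X\}$ with $\Phi(x,\xi)=\phi(h(\xi)-Tx)$ and $\phi(t)=\inf\{\langle q,y\rangle:Wy=t,\ y\ge0\}$. The dual feasible set is $\mathcal D=\{z\in\mathbb{R}^r:W^\top z\le q\}$; $v^1,\ldots,v^\ell$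 denote its vertices, and $\mathcal D={\rm conv}\{v^1,\ldots,v^\ell\}+\{z\in\mathbb{R}^r:W^\top z\le 0\}$. For $t\in W(\mathbb{R}^{\bar m}_+)$ one has $\phi(t)=\max_{j}\langle v^j,t\rangle$. The normal cone to the vertex $v^j$ is $\mathcal K_j=\{t\in W(\mathbb{R}_+^{\bar m}):\langle t,v^i-v^j\rangle\le0\ \forall i\ne j\}$. Two vertices of $\mathcal D$ are adjacent if they are joined by an edge of $\mathcal D$. Assumptions. (A1) $h(\xi)-Tx\in W(\mathbb{R}_+^{\bar m})$ for all $\xi\in\mathbb{R}^d$, $x\in X$ (relatively complete recourse). (A2) $\mathcal D\neq\emptyset$ (dual feasibility). (A3) $\int_{\mathbb{R}^d}\|\xi\|P(d\xi)<\infty$. (A4) $P$ has a density $\rho(\xi)=\prod_{i=1}^d\rho_i(\xi_i)$, where each $\rho_i$ is a continuous probability density on $\mathbb{R}$. (A5) (geometric condition) All components of adjacent vertices of $\mathcal D$ are distinct, i.e. if $v^i,v^j$ are adjacent then $v^i_k\ne v^j_k$ for every component $k$; equivalently, the common closed faces of the normal cones to two adjacent vertices of $\mathcal D$ do not parallel any coordinate axis. Convention: a function is $s$-times continuously differentiable almost everywhere if there is a Lebesgue-null set $N$ such that its partial derivatives up to order $s$ exist and are continuous at every point outside $N$. *)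

theory Defs
  imports "HOL-Probability.Probability"
begin

section \<open>The linear two-stage problem\<close>

text \<open>Vectors of \<open>real ^ 'n\<close> are ordered componentwise by the library's \<open>\<le>\<close>.\<close>

definition pos_image :: "real ^ 'n ^ 'r \<Rightarrow> (real ^ 'r) set" where
  "pos_image W = {W *v y | y. 0 \<le> y}"

definition dual_feasible :: "real ^ 'n ^ 'r \<Rightarrow> real ^ 'n \<Rightarrow> (real ^ 'r) set" where
  "dual_feasible W q = {z. transpose W *v z \<le> q}"

definition vertices :: "(real ^ 'r) set \<Rightarrow> (real ^ 'r) set" where
  "vertices S = {v. v extreme_point_of S}"

definition adjacent :: "(real ^ 'r) set \<Rightarrow> real ^ 'r \<Rightarrow> real ^ 'r \<Rightarrow> bool" where
  "adjacent S v w \<longleftrightarrow> v \<in> vertices S \<and> w \<in> vertices S \<and> closed_segment v w edge_of S"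

text \<open>The vector \<open>(\<xi>, hbar)\<close>. The inequality \<open>d \<le> r\<close> is rendered by an injection
  \<open>\<iota> :: 'd \<Rightarrow> 'r\<close> selecting the coordinates occupied by \<open>\<xi>\<close> (this includes \<open>d = r\<close>). The fixed
  part is carried by a vector indexed by all of \<open>'r\<close>, of which only the components outside
  \<open>range \<iota>\<close> are used.\<close>

definition rhs :: "('d \<Rightarrow> 'r) \<Rightarrow> real ^ 'r \<Rightarrow> real ^ 'd \<Rightarrow> real ^ 'r" where
  "rhs \<iota> hbar \<xi> = (\<chi> i. if i \<in> range \<iota> then \<xi> $ (inv \<iota> i) else hbar $ i)"

definition integrand ::
  "real ^ 'n ^ 'r \<Rightarrow> real ^ 'n \<Rightarrow> real ^ 'm ^ 'r \<Rightarrow> ('d \<Rightarrow> 'r) \<Rightarrow> real ^ 'r \<Rightarrow> real ^ 'm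
    \<Rightarrow> real ^ 'd \<Rightarrow> real" where
  "integrand W q T \<iota> hbar x \<xi> =
     Max ((\<lambda>v. v \<bullet> (rhs \<iota> hbar \<xi> - T *v x)) ` vertices (dual_feasible W q))"

definition continuous_prob_density :: "(real \<Rightarrow> real) \<Rightarrow> bool" where
  "continuous_prob_density g \<longleftrightarrow>
     continuous_on UNIV g \<and> (\<forall>t. 0 \<le> g t) \<and> integrable lborel g \<and> (LINT t|lborel. g t) = 1"

definition kth_projection ::
  "('d \<Rightarrow> real \<Rightarrow> real) \<Rightarrow> 'd \<Rightarrow> (real ^ 'd \<Rightarrow> real) \<Rightarrow> real ^ 'd \<Rightarrow> real" where
  "kth_projection \<rho> k f \<xi> = (LINT s|lborel. f (\<chi> i. if i = k then s else \<xi> $ i) * \<rho> k s)"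

section \<open>Smoothness\<close>

definition continuously_differentiable :: "(real ^ 'd \<Rightarrow> real) \<Rightarrow> bool" where
  "continuously_differentiable F \<longleftrightarrow>
     (\<exists>F' :: real ^ 'd \<Rightarrow> (real ^ 'd) \<Rightarrow>\<^sub>L real.
        (\<forall>\<xi>. (F has_derivative blinfun_apply (F' \<xi>)) (at \<xi>)) \<and> continuous_on UNIV F')"

text \<open>Membership of \<open>g\<close> in \<open>C\<^sup>n(\<real>)\<close>.\<close>

definition C_real :: "nat \<Rightarrow> (real \<Rightarrow> real) \<Rightarrow> bool" where
  "C_real n g \<longleftrightarrow>
     (\<forall>j<n. \<forall>t. (deriv ^^ j) g differentiable (at t)) \<and> continuous_on UNIV ((deriv ^^ n) g)"

definition partial_deriv :: "'d \<Rightarrow> (real ^ 'd \<Rightarrow> real) \<Rightarrow> real ^ 'd \<Rightarrow> real" where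
  "partial_deriv i F \<xi> = deriv (\<lambda>t. F (\<xi> + t *\<^sub>R axis i 1)) 0"

text \<open>All partial derivatives of \<open>F\<close> up to order \<open>s\<close> exist and are continuous at \<open>\<xi>\<close>.
  The list \<open>js\<close> is the order of differentiation: \<open>fold partial_deriv [i, j] F\<close> is the partial
  derivative in direction \<open>j\<close> of the one in direction \<open>i\<close>. Since \<open>deriv\<close> is total, existence is
  asserted separately; it is required on a neighbourhood of \<open>\<xi>\<close>, so that neither a higher partial
  derivative nor continuity at \<open>\<xi>\<close> refers to points where a lower one does not exist.\<close>

definition cont_differentiable_at :: "nat \<Rightarrow> (real ^ 'd \<Rightarrow> real) \<Rightarrow> real ^ 'd \<Rightarrow> bool" where
  "cont_differentiable_at s F \<xi> \<longleftrightarrow>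
     (\<exists>U. open U \<and> \<xi> \<in> U \<and>
        (\<forall>js i. length js < s \<longrightarrow>
           (\<forall>\<eta>\<in>U. (\<lambda>t. fold partial_deriv js F (\<eta> + t *\<^sub>R axis i 1)) differentiable (at 0)))) \<and>
     (\<forall>js. length js \<le> s \<longrightarrow> isCont (fold partial_deriv js F) \<xi>)"

definition cont_differentiable_ae :: "nat \<Rightarrow> (real ^ 'd \<Rightarrow> real) \<Rightarrow> bool" where
  "cont_differentiable_ae s F \<longleftrightarrow>
     (\<exists>N \<in> null_sets lebesgue. \<forall>\<xi>. \<xi> \<notin> N \<longrightarrow> cont_differentiable_at s F \<xi>)"

end

theory Submission
  imports Defs
begin

text \<open>
  Along a line parallel to the \<open>k\<close>th axis the integrand is a maximum of finitely many affine
  functions of \<open>s\<close>, one per vertex. If two vertices are active at a point, the optimal face has two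
  vertices and hence a bounded edge; by the geometric condition the two ends of that edge have
  different slopes in \<open>s\<close>. So on every such line all but finitely many points have a unique active
  vertex, and dominated convergence gives the gradient \<open>\<Sum>v\<in>V. weight v \<xi> *\<^sub>R b v\<close>, where
  \<open>weight v \<xi>\<close> is the probability that \<open>v\<close> is the unique active vertex. The set of such \<open>s\<close> is an
  interval; off finitely many hyperplanes its endpoints are locally affine in \<open>\<xi>\<close>, so \<open>weight v\<close> is
  a difference of values of the distribution function of \<open>\<rho> k\<close> at affine functions and inherits its
  smoothness.
\<close>

section \<open>Edges in faces of polyhedra\<close>

text \<open>Among the faces inside \<open>F\<close> with at least two vertices take one,
  \<open>G\<close>, of least dimension. A functional maximised on \<open>G\<close> at
  \<open>v\<close> alone can be moved until another vertex ties, and minimality then spreads the tie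
  over all of \<open>G\<close>. Varying the starting functional shows that \<open>G\<close> extends
  in one direction only, and a face on a line with two extreme points is the segment between them.
  The cone \<open>C\<close> controls the unbounded directions.\<close>

lemma polyhedron_edge_in_face:
  fixes D :: "'a::euclidean_space set"
  assumes poly: "polyhedron D"
    and dec: "D = {a + b | a b. a \<in> convex hull {v. v extreme_point_of D} \<and> b \<in> C}"
    and C: "cone C" "closed C"
    and F: "F face_of D"
    and vw: "v \<in> F" "w \<in> F" "v extreme_point_of D" "w extreme_point_of D" "v \<noteq> w"
  obtains v' w' where "v' \<in> F" "w' \<in> F" "v' extreme_point_of D" "w' extreme_point_of D"
    "closed_segment v' w' edge_of D"
proof -
  let ?V = "{v. v extreme_point_of D}"
  define two where "two H \<longleftrightarrow> (\<exists>v\<in>H. \<exists>w\<in>H. v \<noteq> w \<and> v extreme_point_of D \<and> w extreme_point_of D)"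
    for H :: "'a set"
  \<comment> \<open>\<open>aff_dim\<close> is an integer (-1 for the empty set); \<open>nat\<close>
    turns it into a measure for the choice of a least element, and faces with two vertices are
    nonempty, so no information is lost.\<close>
  have "\<exists>G. (G face_of D \<and> G \<subseteq> F \<and> two G) \<and>
      (\<forall>H. H face_of D \<and> H \<subseteq> F \<and> two H \<longrightarrow> nat (aff_dim G) \<le> nat (aff_dim H))"
    by (rule ex_has_least_nat[of _ F]) (use F vw in \<open>auto simp: two_def\<close>)
  then obtain G where G: "G face_of D" "G \<subseteq> F" "two G"
    and least: "\<And>H. H face_of D \<Longrightarrow> H \<subseteq> F \<Longrightarrow> two H \<Longrightarrow> nat (aff_dim G) \<le> nat (aff_dim H)"
    by blast
  have convG: "convex G" using G(1) face_of_imp_convex by blast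
  have polyG: "polyhedron G" using face_of_polyhedron_polyhedron[OF poly G(1)] .
  have GD: "G \<subseteq> D" using G(1) face_of_imp_subset by blast
  have minimal: "H = G" if H: "H face_of G" "two H" for H
  proof (rule ccontr)
    assume "H \<noteq> G"
    then have lt: "aff_dim H < aff_dim G" using face_of_aff_dim_lt[OF convG H(1)] by blast
    have "H \<noteq> {}" using H(2) by (auto simp: two_def)
    then have "0 \<le> aff_dim H" by (metis aff_dim_negative_iff not_le)
    moreover have "H face_of D" "H \<subseteq> F"
      using face_of_trans[OF H(1) G(1)] face_of_imp_subset[OF H(1)] G(2) by auto
    ultimately show False using least[OF _ _ H(2)] lt by fastforce
  qed
  have faceG: "a \<in> G \<and> b \<in> G" if "a \<in> D" "b \<in> D" "a \<noteq> b" "(1/2) *\<^sub>R (a + b) \<in> G" for a b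
  proof -
    have "(1/2) *\<^sub>R (a + b) = midpoint a b" by (simp add: midpoint_def)
    then show ?thesis
      using face_ofD[OF G(1) _ that(1,2,4)] that(3) midpoint_in_open_segment[of a b] by simp
  qed
  define E where "E = G \<inter> ?V"
  have finE: "finite E"
    unfolding E_def using finite_polyhedron_extreme_points[OF poly] by simp
  from G(3) obtain v w where vw: "v \<in> E" "w \<in> E" "v \<noteq> w"
    unfolding two_def E_def by blast
  \<comment> \<open>The recession directions of \<open>G\<close>, read off at the base point
    \<open>v\<close>; \<open>shift\<close> makes them independent of the vertex chosen.\<close>
  define R where "R = {b \<in> C. v + b \<in> G}"
  have scaleC: "c *\<^sub>R b \<in> C" if "b \<in> C" "0 \<le> c" for b c
    using C(1) that by (auto simp: cone_def)
  have hullD: "a + b \<in> D" if "a \<in> convex hull ?V" "b \<in> C" for a b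
    using that by (subst dec) blast
  have ED: "u + b \<in> D" if "u \<in> E" "b \<in> C" for u b
    using that by (intro hullD hull_inc) (auto simp: E_def)
  \<comment> \<open>The segments from \<open>u\<close> to \<open>a + b\<close> and from
    \<open>a\<close> to \<open>u + b\<close> share their midpoint. It lies in \<open>G\<close> by
    convexity, so the face property puts \<open>u + b\<close> into \<open>G\<close>.\<close>
  have shift: "u + b \<in> G" if u: "u \<in> E" and b: "b \<in> C" "a \<in> G" "a + b \<in> G" for u a b
  proof (cases "a = u + b")
    case False
    have uG: "u \<in> G" using u by (auto simp: E_def)
    have "(1/2) *\<^sub>R u + (1/2) *\<^sub>R (a + b) \<in> G"
      by (rule convexD[OF convG uG b(3)]) auto
    then have "(1/2) *\<^sub>R (a + (u + b)) \<in> G"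
      by (simp add: algebra_simps)
    then show ?thesis using faceG[of a "u + b"] False ED[OF u b(1)] b(2) GD by blast
  qed (use that in simp)
  \<comment> \<open>\<open>G\<close> inherits the decomposition of \<open>D\<close>. The point
    \<open>z = a + b\<close> is the midpoint of \<open>a\<close> and
    \<open>a + 2 *\<^sub>R b\<close>, so \<open>a\<close> lies in \<open>G\<close>; and
    \<open>G\<close> cuts a face out of the hull of the vertices, which is the hull of some of
    them.\<close>
  have decG: "\<exists>a b. z = a + b \<and> a \<in> convex hull E \<and> b \<in> R" if z: "z \<in> G" for z
  proof -
    obtain a b where ab: "z = a + b" "a \<in> convex hull ?V" "b \<in> C"
      using z GD dec by blast
    have aG: "a \<in> G"
    proof (cases "b = 0")
      case False
      have zC: "0 *\<^sub>R b \<in> C" by (rule scaleC[OF ab(3)]) simp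
      have "a + 2 *\<^sub>R b \<in> D" using hullD[OF ab(2) scaleC[OF ab(3), of 2]] by simp
      moreover have "a \<in> D" using hullD[OF ab(2) zC] by simp
      moreover have "(1/2) *\<^sub>R (a + (a + 2 *\<^sub>R b)) = z"
        by (simp add: ab(1) algebra_simps flip: scaleR_2)
      ultimately show ?thesis using faceG[of a "a + 2 *\<^sub>R b"] z False by simp
    qed (use ab z in simp)
    have "(G \<inter> convex hull ?V) face_of (D \<inter> convex hull ?V)"
      by (rule face_of_slice[OF G(1)]) simp
    moreover have "D \<inter> convex hull ?V = convex hull ?V"
    proof -
      have "?V \<subseteq> D" by (auto simp: extreme_point_of_def)
      then have "convex hull ?V \<subseteq> D"
        by (simp add: hull_minimal polyhedron_imp_convex[OF poly])
      then show ?thesis by blast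
    qed
    ultimately have "(G \<inter> convex hull ?V) face_of (convex hull ?V)" by simp
    then obtain S' where S': "S' \<subseteq> ?V" "G \<inter> convex hull ?V = convex hull S'"
      using face_of_convex_hull_subset finite_imp_compact finite_polyhedron_extreme_points[OF poly]
      by metis
    have "S' \<subseteq> E" using S' hull_subset[of S' convex] unfolding E_def by blast
    then have "a \<in> convex hull E" using aG ab(2) S'(2) hull_mono by blast
    moreover have "b \<in> R" using shift[OF vw(1) ab(3) aG] z ab by (simp add: R_def)
    ultimately show ?thesis using ab(1) by blast
  qed
  \<comment> \<open>Shrinking is convexity; for stretching, \<open>v + b\<close> lies strictly
    between \<open>v\<close> and \<open>v + c *\<^sub>R b\<close>, and the face property
    applies.\<close>
  have scaleR: "c *\<^sub>R b \<in> R" if b: "b \<in> R" and c: "0 < c" for b c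
  proof -
    have vG: "v \<in> G" using vw by (simp add: E_def)
    have vD: "v + c *\<^sub>R b \<in> D" using ED[OF vw(1) scaleC] b c by (auto simp: R_def)
    have "v + c *\<^sub>R b \<in> G"
    proof (cases "c \<le> 1")
      case True
      have "(1 - c) *\<^sub>R v + c *\<^sub>R (v + b) \<in> G"
        using convexD_alt[OF convG vG, of "v + b" c] b c True by (auto simp: R_def)
      then show ?thesis by (simp add: algebra_simps)
    next
      case False
      show ?thesis
      proof (cases "b = 0")
        case nz: False
        have "v + b \<in> open_segment v (v + c *\<^sub>R b)"
          unfolding in_segment using False nz
          by (intro conjI exI[of _ "1/c"]) (auto simp: algebra_simps)
        then show ?thesis
          using face_ofD[OF G(1), of "v + b" v "v + c *\<^sub>R b"] b vG vD GD by (auto simp: R_def)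
      qed (use vG in simp)
    qed
    then show ?thesis using scaleC b c by (auto simp: R_def)
  qed
  have closedR: "closed R"
  proof -
    have "R = C \<inter> (\<lambda>b. v + b) -` G" by (auto simp: R_def)
    moreover have "closed ((\<lambda>b. v + b) -` G)"
      by (intro closed_vimage polyhedron_imp_closed[OF polyG] continuous_intros)
    ultimately show ?thesis using C(2) by auto
  qed
  \<comment> \<open>For a vertex \<open>u\<close> of \<open>G\<close>, these are the functionals
    whose only maximiser on \<open>G\<close> is \<open>u\<close>, expressed by vertices and
    recession directions.\<close>
  define K where "K u = {c. (\<forall>z\<in>E - {u}. c \<bullet> z < c \<bullet> u) \<and> (\<forall>b\<in>R - {0}. c \<bullet> b < 0)}" for u
  \<comment> \<open>Faces of a polyhedron are exposed, so the vertex \<open>u\<close> has a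
    functional maximised on \<open>G\<close> at \<open>u\<close> only.\<close>
  have K_ne: "\<exists>c. c \<in> K u" if u: "u \<in> E" for u
  proof -
    have "u extreme_point_of G"
      using u extreme_point_of_face[OF G(1)] by (auto simp: E_def)
    then have "{u} face_of G" by (simp add: face_of_singleton)
    then have "{u} exposed_face_of G" using exposed_face_of_polyhedron[OF polyG] by simp
    then obtain c r where c: "G \<subseteq> {x. c \<bullet> x \<le> r}" "{u} = G \<inter> {x. c \<bullet> x = r}"
      unfolding exposed_face_of_def by blast
    have lt: "c \<bullet> z < c \<bullet> u" if "z \<in> G" "z \<noteq> u" for z
    proof -
      have "c \<bullet> z \<le> r" "c \<bullet> u = r" "c \<bullet> z \<noteq> r" using c that by blast+
      then show ?thesis by simp
    qed
    have "c \<bullet> b < 0" if "b \<in> R" "b \<noteq> 0" for b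
    proof -
      have "v \<in> G" using vw by (simp add: E_def)
      then have "u + b \<in> G" using shift[OF u, of b v] that by (simp add: R_def)
      from lt[OF this] that show ?thesis by (simp add: inner_add_right)
    qed
    then have "c \<in> K u" using lt by (auto simp: K_def E_def)
    then show ?thesis ..
  qed
  have bound: "c \<bullet> z \<le> c \<bullet> u" if "\<And>z. z \<in> E \<Longrightarrow> c \<bullet> z \<le> c \<bullet> u" "\<And>b. b \<in> R \<Longrightarrow> c \<bullet> b \<le> 0" and z: "z \<in> G"
    for c u z
  proof -
    obtain a b where ab: "z = a + b" "a \<in> convex hull E" "b \<in> R" using decG[OF z] by blast
    have "convex hull E \<subseteq> {x. c \<bullet> x \<le> c \<bullet> u}"
      by (rule hull_minimal) (use that(1) in \<open>auto simp: convex_halfspace_le\<close>)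
    then have "c \<bullet> a \<le> c \<bullet> u" using ab(2) by blast
    with that(2)[OF ab(3)] show ?thesis by (simp add: ab(1) inner_add_right)
  qed
  txt \<open>At the first \<open>\<mu>\<close> where \<open>v\<close> stops being the only maximiser of \<open>c0 + \<mu> *\<^sub>R c1\<close>, the
    maximisers form a face with two vertices, which is \<open>G\<close> by minimality.\<close>
  have const: "\<exists>\<mu>. \<forall>z\<in>G. (c0 + \<mu> *\<^sub>R c1) \<bullet> (z - v) = 0" if c0: "c0 \<in> K v" and c1: "c1 \<in> K w"
    for c0 c1
  proof -
    \<comment> \<open>Only vertices that gain on \<open>v\<close> along \<open>c1\<close> can catch
      up with it; \<open>\<mu> z\<close> is the parameter at which \<open>z\<close> ties with
      \<open>v\<close>. Recession directions stay nonpositive, since both \<open>c0\<close> and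
      \<open>c1\<close> are negative on them.\<close>
    define B where "B = {z \<in> E. 0 < c1 \<bullet> (z - v)}"
    define \<mu> where "\<mu> z = - (c0 \<bullet> (z - v)) / (c1 \<bullet> (z - v))" for z
    have "w \<in> B" using vw c1 by (auto simp: B_def K_def inner_diff_right)
    moreover have "finite B" using finE by (simp add: B_def)
    ultimately obtain z0 where z0: "z0 \<in> B" "\<And>z. z \<in> B \<Longrightarrow> \<mu> z0 \<le> \<mu> z"
      using arg_min_if_finite[of B \<mu>] by (metis empty_iff not_le)
    let ?c = "c0 + \<mu> z0 *\<^sub>R c1"
    have neg: "c0 \<bullet> (z - v) < 0" if "z \<in> E" "z \<noteq> v" for z
      using c0 that by (auto simp: K_def inner_diff_right)
    have Bv: "z \<noteq> v" if "z \<in> B" for z using that by (auto simp: B_def)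
    have pos: "0 < \<mu> z" if "z \<in> B" for z
      using that neg[of z] Bv[OF that] by (auto simp: \<mu>_def B_def intro!: divide_neg_pos)
    have le: "?c \<bullet> z \<le> ?c \<bullet> v" if z: "z \<in> E" for z
    proof (cases "z \<in> B")
      case True
      have "\<mu> z0 * (c1 \<bullet> (z - v)) \<le> \<mu> z * (c1 \<bullet> (z - v))"
        using z0(2)[OF True] True by (intro mult_right_mono) (auto simp: B_def)
      also have "\<dots> = - (c0 \<bullet> (z - v))" using True by (auto simp: \<mu>_def B_def)
      finally show ?thesis by (simp add: inner_simps algebra_simps)
    next
      case False
      then have "\<mu> z0 * (c1 \<bullet> (z - v)) \<le> 0"
        using z pos[OF z0(1)] by (auto simp: B_def mult_le_0_iff)
      moreover have "c0 \<bullet> (z - v) \<le> 0" using neg[OF z] by (cases "z = v") auto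
      ultimately show ?thesis by (simp add: inner_simps algebra_simps)
    qed
    have Rle: "?c \<bullet> b \<le> 0" if b: "b \<in> R" for b
    proof (cases "b = 0")
      case False
      then have "c0 \<bullet> b < 0" "c1 \<bullet> b < 0" using b c0 c1 by (auto simp: K_def)
      then have "\<mu> z0 * (c1 \<bullet> b) \<le> 0"
        using pos[OF z0(1)] by (simp add: mult_le_0_iff)
      then show ?thesis using \<open>c0 \<bullet> b < 0\<close> by (simp add: inner_simps)
    qed simp
    have all: "?c \<bullet> z \<le> ?c \<bullet> v" if "z \<in> G" for z using bound[OF le Rle that] .
    let ?H = "G \<inter> {z. ?c \<bullet> z = ?c \<bullet> v}"
    have "?H face_of G" by (rule face_of_Int_supporting_hyperplane_le[OF convG all])
    moreover have "two ?H"
    proof -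
      have "?c \<bullet> z0 = ?c \<bullet> v"
        using z0(1) by (auto simp: B_def \<mu>_def inner_simps field_simps)
      then show ?thesis unfolding two_def
        using vw(1) z0(1) Bv[OF z0(1)] by (intro bexI[of _ v] bexI[of _ z0]) (auto simp: E_def B_def)
    qed
    ultimately have "?H = G" by (rule minimal)
    then show ?thesis by (intro exI[of _ "\<mu> z0"]) (auto simp: inner_diff_right)
  qed
  \<comment> \<open>\<open>K v\<close> is open: \<open>c0\<close> is negative on the compact set of
    vertex differences and unit recession directions, hence bounded away from 0 there.\<close>
  have perturb: "\<exists>\<epsilon>>0. c0 + \<epsilon> *\<^sub>R c' \<in> K v" if c0: "c0 \<in> K v" for c0 c'
  proof -
    let ?Z = "(\<lambda>z. z - v) ` (E - {v}) \<union> (R \<inter> sphere 0 1)"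
    have cZ: "compact ?Z"
      using finE by (intro compact_Un finite_imp_compact closed_Int_compact closedR compact_sphere) auto
    have "w - v \<in> ?Z" using vw by auto
    then have "?Z \<noteq> {}" by blast
    then obtain y where y: "y \<in> ?Z" "\<And>z. z \<in> ?Z \<Longrightarrow> c0 \<bullet> z \<le> c0 \<bullet> y"
      using continuous_attains_sup[OF cZ _ continuous_on_inner[OF continuous_on_const continuous_on_id], of c0]
      by metis
    have neg: "c0 \<bullet> y < 0" using y(1) c0 by (auto simp: K_def inner_diff_right)
    obtain B where B: "\<And>z. z \<in> ?Z \<Longrightarrow> norm z \<le> B" "0 < B"
      using compact_imp_bounded[OF cZ] by (meson bounded_pos)
    \<comment> \<open>The summand 1 keeps the denominator positive when \<open>c' = 0\<close> and
      makes the estimate below strict.\<close>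
    define \<epsilon> where "\<epsilon> = - (c0 \<bullet> y) / (B * norm c' + 1)"
    have den: "0 < B * norm c' + 1" using B(2) by (simp add: add_nonneg_pos)
    have \<epsilon>: "0 < \<epsilon>" using neg den by (simp add: \<epsilon>_def divide_neg_pos)
    have lt: "(c0 + \<epsilon> *\<^sub>R c') \<bullet> z < 0" if z: "z \<in> ?Z" for z
    proof -
      have "c' \<bullet> z \<le> norm c' * norm z" by (rule norm_cauchy_schwarz)
      also have "\<dots> \<le> norm c' * B" using B(1)[OF z] by (simp add: mult_left_mono)
      finally have "\<epsilon> * (c' \<bullet> z) \<le> \<epsilon> * (B * norm c')"
        using \<epsilon> by (simp add: mult.commute)
      also have "\<dots> < \<epsilon> * (B * norm c' + 1)" using \<epsilon> by simp
      also have "\<dots> = - (c0 \<bullet> y)" using den by (simp add: \<epsilon>_def)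
      finally show ?thesis using y(2)[OF z] by (simp add: inner_simps)
    qed
    have "(c0 + \<epsilon> *\<^sub>R c') \<bullet> b < 0" if b: "b \<in> R" "b \<noteq> 0" for b
    proof -
      have "(1 / norm b) *\<^sub>R b \<in> ?Z" using scaleR[OF b(1), of "1 / norm b"] b by simp
      from lt[OF this] b(2) show ?thesis by (simp add: divide_less_0_iff)
    qed
    moreover have "(c0 + \<epsilon> *\<^sub>R c') \<bullet> z < (c0 + \<epsilon> *\<^sub>R c') \<bullet> v" if "z \<in> E - {v}" for z
      using lt[of "z - v"] that by (simp add: inner_diff_right)
    ultimately have "c0 + \<epsilon> *\<^sub>R c' \<in> K v" by (auto simp: K_def)
    with \<epsilon> show ?thesis by blast
  qed
  have collinear: "u - v \<in> span {w - v}" if u: "u \<in> G" for u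
  proof -
    let ?y = "w - v"
    \<comment> \<open>The part of \<open>u - v\<close> orthogonal to \<open>w - v\<close>; the aim
      is to show that it vanishes.\<close>
    define c' where "c' = (u - v) - (((u - v) \<bullet> ?y) / (?y \<bullet> ?y)) *\<^sub>R ?y"
    have "?y \<bullet> ?y \<noteq> 0" using vw(3) by simp
    then have orth: "c' \<bullet> ?y = 0" unfolding c'_def inner_diff_left inner_scaleR_left by simp
    obtain c0 c1 where c: "c0 \<in> K v" "c1 \<in> K w" using K_ne vw by blast
    obtain \<epsilon> where \<epsilon>: "0 < \<epsilon>" "c0 + \<epsilon> *\<^sub>R c' \<in> K v" using perturb[OF c(1)] by blast
    obtain \<mu> where \<mu>: "\<And>z. z \<in> G \<Longrightarrow> (c0 + \<mu> *\<^sub>R c1) \<bullet> (z - v) = 0"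
      using const[OF c] by blast
    obtain \<mu>' where \<mu>': "\<And>z. z \<in> G \<Longrightarrow> (c0 + \<epsilon> *\<^sub>R c' + \<mu>' *\<^sub>R c1) \<bullet> (z - v) = 0"
      using const[OF \<epsilon>(2) c(2)] by blast
    have wG: "w \<in> G" using vw by (simp add: E_def)
    have "0 < c1 \<bullet> ?y" using c(2) vw by (auto simp: K_def inner_diff_right)
    \<comment> \<open>Adding a multiple of \<open>c'\<close> leaves the value at
      \<open>w - v\<close> unchanged, so both starting functionals have the same tie parameter.
      Subtracting the two identities leaves \<open>c'\<close> orthogonal to \<open>u - v\<close>,
      hence to itself.\<close>
    moreover have "\<mu> * (c1 \<bullet> ?y) = \<mu>' * (c1 \<bullet> ?y)"
      using \<mu>[OF wG] \<mu>'[OF wG] unfolding inner_add_left inner_scaleR_left orth mult_zero_right by linarith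
    ultimately have "\<mu> = \<mu>'" by simp
    then have "c' \<bullet> (u - v) = 0" using \<mu>[OF u] \<mu>'[OF u] \<epsilon>(1)
      unfolding inner_add_left inner_scaleR_left by (smt (verit) mult_eq_0_iff)
    moreover have "u - v = c' + (((u - v) \<bullet> ?y) / (?y \<bullet> ?y)) *\<^sub>R ?y" by (simp add: c'_def)
    ultimately have "c' \<bullet> c' = 0" using orth by (metis add.right_neutral inner_add_right inner_scaleR_right mult_zero_right)
    then have "u - v = (((u - v) \<bullet> ?y) / (?y \<bullet> ?y)) *\<^sub>R ?y" by (simp add: c'_def)
    then show ?thesis by (metis span_base span_scale singletonI)
  qed
  have GE: "G = closed_segment v w"
  proof
    show "closed_segment v w \<subseteq> G"
      using vw convG by (simp add: E_def closed_segment_subset)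
    show "G \<subseteq> closed_segment v w"
    proof
      fix u assume u: "u \<in> G"
      then obtain l where l: "u - v = l *\<^sub>R (w - v)" using collinear by (auto simp: span_singleton)
      have ul: "u = v + l *\<^sub>R (w - v)" using l by (simp add: algebra_simps)
      have ext: "v extreme_point_of G" "w extreme_point_of G"
        using vw extreme_point_of_face[OF G(1)] by (auto simp: E_def)
      have "0 \<le> l"
      proof (rule ccontr)
        assume "\<not> 0 \<le> l"
        \<comment> \<open>If \<open>l\<close> were negative, \<open>v\<close> would lie strictly
          between \<open>u\<close> and \<open>w\<close>; \<open>\<kappa>\<close> is its position on
          that segment.\<close>
        define \<kappa> where "\<kappa> = - l / (1 - l)"
        have \<kappa>: "0 < \<kappa>" "\<kappa> < 1" "l + \<kappa> * (1 - l) = 0"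
          using \<open>\<not> 0 \<le> l\<close> by (auto simp: \<kappa>_def field_simps)
        have "(1 - \<kappa>) *\<^sub>R u + \<kappa> *\<^sub>R w = v + (l + \<kappa> * (1 - l)) *\<^sub>R (w - v)"
          unfolding ul by (simp add: algebra_simps)
        then have "v = (1 - \<kappa>) *\<^sub>R u + \<kappa> *\<^sub>R w" using \<kappa>(3) by simp
        moreover have "u \<noteq> w" using \<open>\<not> 0 \<le> l\<close> l vw(3)
          by (metis eq_iff_diff_eq_0 scaleR_cancel_right scaleR_one zero_le_one)
        ultimately have "v \<in> open_segment u w" unfolding in_segment using \<kappa>(1,2) by blast
        then show False using ext u vw by (auto simp: extreme_point_of_def E_def)
      qed
      moreover have "l \<le> 1"
      proof (rule ccontr)
        assume "\<not> l \<le> 1"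
        then have "w \<in> open_segment v u" unfolding in_segment using vw(3)
          by (intro conjI exI[of _ "1 / l"]) (auto simp: ul algebra_simps)
        then show False using ext u vw by (auto simp: extreme_point_of_def E_def)
      qed
      ultimately show "u \<in> closed_segment v w"
        unfolding in_segment by (intro exI[of _ l]) (simp add: ul algebra_simps)
    qed
  qed
  have "aff_dim (closed_segment v w) = 1"
    using vw(3) by (simp add: segment_convex_hull aff_dim_convex_hull aff_dim_2)
  then have "closed_segment v w edge_of D" using G(1) by (simp add: edge_of_def GE)
  then show thesis using that vw G(2) by (auto simp: E_def)
qed

section \<open>Functions with continuous partial derivatives on an open set\<close>

text \<open>Recursive counterpart of \<open>cont_differentiable_at\<close> on a whole set. Peeling
  off the first direction matches the unfolding of \<open>fold partial_deriv (i # js)\<close> and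
  gives closure properties by induction on the order.\<close>

primrec smooth_on :: "(real ^ 'd::finite) set \<Rightarrow> nat \<Rightarrow> (real ^ 'd \<Rightarrow> real) \<Rightarrow> bool" where
  "smooth_on U 0 F \<longleftrightarrow> continuous_on U F"
| "smooth_on U (Suc n) F \<longleftrightarrow> continuous_on U F \<and>
    (\<forall>i. (\<forall>\<eta>\<in>U. (\<lambda>t. F (\<eta> + t *\<^sub>R axis i 1)) differentiable (at 0)) \<and>
      smooth_on U n (partial_deriv i F))"

lemma smooth_on_imp_continuous: "smooth_on U n F \<Longrightarrow> continuous_on U F"
  by (cases n) auto

lemma partial_deriv_eqI:
  assumes "((\<lambda>t. F (\<eta> + t *\<^sub>R axis i 1)) has_real_derivative D) (at 0)"
  shows "partial_deriv i F \<eta> = D"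
  using assms by (simp add: partial_deriv_def DERIV_imp_deriv)

lemma line_derivative_transform:
  fixes F G :: "real ^ 'd::finite \<Rightarrow> real"
  assumes U: "open U" "\<eta> \<in> U" "\<And>y. y \<in> U \<Longrightarrow> F y = G y"
    and F: "((\<lambda>t. F (\<eta> + t *\<^sub>R axis i 1)) has_real_derivative D) (at 0)"
  shows "((\<lambda>t. G (\<eta> + t *\<^sub>R axis i 1)) has_real_derivative D) (at 0)"
proof (rule has_field_derivative_transform_within_open[OF F])
  show "open ((\<lambda>t. \<eta> + t *\<^sub>R axis i 1) -` U)"
    by (rule open_vimage[OF U(1)]) (auto intro!: continuous_intros)
qed (use U in auto)

lemma line_has_derivative:
  "(\<lambda>t. F (\<eta> + t *\<^sub>R axis i 1)) differentiable (at 0) \<Longrightarrow>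
    ((\<lambda>t. F (\<eta> + t *\<^sub>R axis i 1)) has_real_derivative partial_deriv i F \<eta>) (at 0)"
  unfolding partial_deriv_def
  by (metis DERIV_deriv_iff_real_differentiable)

text \<open>On an open set equal functions have equal partial derivatives, so the agreement passes
  down the recursion.\<close>

lemma smooth_on_cong:
  "open U \<Longrightarrow> smooth_on U n F \<Longrightarrow> (\<And>\<eta>. \<eta> \<in> U \<Longrightarrow> F \<eta> = G \<eta>) \<Longrightarrow> smooth_on U n G"
proof (induction n arbitrary: F G)
  case 0
  then show ?case by (metis continuous_on_cong smooth_on.simps(1))
next
  case (Suc n)
  have cont: "continuous_on U G"
    using Suc.prems by (metis continuous_on_cong smooth_on_imp_continuous)
  have der: "((\<lambda>t. G (\<eta> + t *\<^sub>R axis i 1)) has_real_derivative partial_deriv i F \<eta>) (at 0)"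
    if "\<eta> \<in> U" for i \<eta>
    using Suc.prems that by (intro line_derivative_transform[of U \<eta> F G] line_has_derivative) auto
  have "smooth_on U n (partial_deriv i G)" for i
    by (rule Suc.IH[of "partial_deriv i F"]) (use Suc.prems partial_deriv_eqI[OF der] in auto)
  with cont der show ?case by (auto simp: real_differentiable_def)
qed

text \<open>Lets the partial derivatives be given by explicit formulas \<open>D i\<close> valid on
  \<open>U\<close>, in place of the total operator \<open>partial_deriv\<close>.\<close>

lemma smooth_on_SucI:
  assumes "open U" "continuous_on U F"
    and der: "\<And>i \<eta>. \<eta> \<in> U \<Longrightarrow>
      ((\<lambda>t. F (\<eta> + t *\<^sub>R axis i 1)) has_real_derivative D i \<eta>) (at 0)"
    and D: "\<And>i. smooth_on U n (D i)"
  shows "smooth_on U (Suc n) F"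
  using assms(2) der smooth_on_cong[OF assms(1) D] partial_deriv_eqI[OF der]
  by (auto simp: real_differentiable_def)

lemma smooth_on_const: "open U \<Longrightarrow> smooth_on U n (\<lambda>_. c)"
  by (induction n arbitrary: c) (auto intro!: smooth_on_SucI[where D = "\<lambda>_ _. 0"] simp del: smooth_on.simps(2))

lemma smooth_on_add:
  "open U \<Longrightarrow> smooth_on U n F \<Longrightarrow> smooth_on U n G \<Longrightarrow> smooth_on U n (\<lambda>\<eta>. F \<eta> + G \<eta>)"
proof (induction n arbitrary: F G)
  case (Suc n)
  show ?case
  proof (rule smooth_on_SucI)
    show "((\<lambda>t. F (\<eta> + t *\<^sub>R axis i 1) + G (\<eta> + t *\<^sub>R axis i 1))
        has_real_derivative partial_deriv i F \<eta> + partial_deriv i G \<eta>) (at 0)"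
      if "\<eta> \<in> U" for i \<eta>
      using Suc.prems that by (intro DERIV_add line_has_derivative) auto
  qed (use Suc in \<open>auto intro!: continuous_intros\<close>)
qed (auto intro: continuous_intros)

lemma smooth_on_cmult:
  "open U \<Longrightarrow> smooth_on U n F \<Longrightarrow> smooth_on U n (\<lambda>\<eta>. c * F \<eta>)"
proof (induction n arbitrary: F)
  case (Suc n)
  show ?case
  proof (rule smooth_on_SucI)
    show "((\<lambda>t. c * F (\<eta> + t *\<^sub>R axis i 1)) has_real_derivative c * partial_deriv i F \<eta>) (at 0)"
      if "\<eta> \<in> U" for i \<eta>
      using Suc.prems that by (intro DERIV_cmult line_has_derivative) auto
  qed (use Suc in \<open>auto intro!: continuous_intros\<close>)
qed (auto intro: continuous_intros)

lemma smooth_on_sum: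
  assumes "open U" "\<And>j. j \<in> J \<Longrightarrow> smooth_on U n (F j)"
  shows "smooth_on U n (\<lambda>\<eta>. \<Sum>j\<in>J. F j \<eta>)"
  using assms(2)
  by (induction J rule: infinite_finite_induct)
    (simp_all add: smooth_on_const smooth_on_add assms(1))

lemma smooth_on_fold_partial_deriv:
  "smooth_on U n F \<Longrightarrow> length js \<le> n \<Longrightarrow> smooth_on U (n - length js) (fold partial_deriv js F)"
proof (induction js arbitrary: n F)
  case (Cons i js)
  then obtain n' where "n = Suc n'" by (cases n) auto
  then show ?case using Cons by auto
qed simp

lemma smooth_on_imp_cont_differentiable_at:
  fixes F :: "real ^ 'd::finite \<Rightarrow> real"
  assumes U: "open U" "\<xi> \<in> U" and F: "smooth_on U n F"
  shows "cont_differentiable_at n F \<xi>"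
  unfolding cont_differentiable_at_def
proof (intro conjI exI[of _ U] allI impI ballI U)
  fix js :: "'d list" and i \<eta> assume "length js < n" "\<eta> \<in> U"
  then show "(\<lambda>t. fold partial_deriv js F (\<eta> + t *\<^sub>R axis i 1)) differentiable (at 0)"
    using smooth_on_fold_partial_deriv[OF F, of js] by (cases "n - length js") auto
next
  fix js :: "'d list" assume "length js \<le> n"
  then show "isCont (fold partial_deriv js F) \<xi>"
    using smooth_on_imp_continuous[OF smooth_on_fold_partial_deriv[OF F]] U
    by (simp add: continuous_on_eq_continuous_at)
qed

section \<open>Smooth functions of one real variable and their compositions with affine maps\<close>

lemma funpow_Suc_deriv: "(deriv ^^ Suc j) g = (deriv ^^ j) (deriv g)"
  by (simp add: funpow_Suc_right del: funpow.simps)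

text \<open>Used for the distribution function, which is one order smoother than its
  density.\<close>

lemma C_real_SucI:
  assumes g: "\<And>t. (g has_real_derivative g' t) (at t)" and g': "C_real n g'"
  shows "C_real (Suc n) g"
proof -
  have "deriv g = g'" using g by (auto intro: DERIV_imp_deriv)
  then have eq: "(deriv ^^ Suc j) g = (deriv ^^ j) g'" for j by (simp only: funpow_Suc_deriv)
  have "(deriv ^^ j) g differentiable (at t)" if "j < Suc n" for j t
  proof (cases j)
    case 0
    then show ?thesis using g by (auto simp: real_differentiable_def)
  next
    case (Suc j')
    then show ?thesis using g' that unfolding Suc eq C_real_def by simp
  qed
  moreover have "continuous_on UNIV ((deriv ^^ Suc n) g)" using g' unfolding eq C_real_def by simp
  ultimately show ?thesis unfolding C_real_def by blast
qed

lemma C_real_SucD: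
  assumes "C_real (Suc n) g"
  shows "(g has_real_derivative deriv g t) (at t)" "C_real n (deriv g)"
proof -
  have "(deriv ^^ 0) g differentiable (at t)" using assms unfolding C_real_def by blast
  then show "(g has_real_derivative deriv g t) (at t)"
    by (simp add: DERIV_deriv_iff_real_differentiable)
  show "C_real n (deriv g)"
    using assms unfolding C_real_def by (metis Suc_mono funpow_Suc_deriv)
qed

text \<open>By the chain rule the \<open>i\<close>th partial derivative is \<open>b $ i\<close>
  times the same kind of function built from \<open>deriv g\<close>, so induction on the order
  applies.\<close>

lemma smooth_on_ridge:
  "open U \<Longrightarrow> C_real n g \<Longrightarrow> smooth_on U n (\<lambda>\<eta>. g (b \<bullet> \<eta> + c))"
proof (induction n arbitrary: g)
  case 0
  then show ?case
    by (auto simp: C_real_def intro!: continuous_on_compose2[of UNIV g] continuous_intros)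
next
  case (Suc n)
  note g = C_real_SucD[OF Suc.prems(2)]
  show ?case
  proof (rule smooth_on_SucI)
    have cg: "continuous_on UNIV g" using g(1) by (auto intro!: DERIV_continuous_on)
    then show "continuous_on U (\<lambda>\<eta>. g (b \<bullet> \<eta> + c))"
      by (auto intro!: continuous_on_compose2[of UNIV g] continuous_intros)
    show "((\<lambda>t. g (b \<bullet> (\<eta> + t *\<^sub>R axis i 1) + c)) has_real_derivative
        b $ i * deriv g (b \<bullet> \<eta> + c)) (at 0)" for i \<eta>
    proof -
      have "((\<lambda>t. b \<bullet> (\<eta> + t *\<^sub>R axis i 1) + c) has_real_derivative b $ i) (at 0)"
        by (auto intro!: derivative_eq_intros simp: inner_axis inner_add_right)
      moreover have "(g has_real_derivative deriv g (b \<bullet> \<eta> + c)) (at (b \<bullet> (\<eta> + 0 *\<^sub>R axis i 1) + c))"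
        using g(1) by simp
      ultimately show ?thesis by (metis DERIV_chain2 mult.commute)
    qed
    show "smooth_on U n (\<lambda>\<eta>. b $ i * deriv g (b \<bullet> \<eta> + c))" for i
      by (intro smooth_on_cmult Suc.IH Suc.prems g(2))
  qed (rule Suc.prems)
qed

section \<open>Sign patterns of finitely many affine functions\<close>

lemma affine_sign_locally_constant:
  fixes H :: "('a::euclidean_space \<times> real) set"
  assumes "finite H"
  obtains N where "negligible N" "\<And>\<xi>. \<xi> \<notin> N \<Longrightarrow>
    \<exists>U. open U \<and> \<xi> \<in> U \<and> (\<forall>(c, e)\<in>H. \<forall>\<eta>\<in>U. sgn (c \<bullet> \<eta> + e) = sgn (c \<bullet> \<xi> + e))"
proof
  \<comment> \<open>The zero sets of the affine functions, each a hyperplane or empty. The zero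
    function is left out: it vanishes everywhere, but its sign is constant.\<close>
  let ?N = "\<Union>(c, e)\<in>H - {(0, 0)}. {\<eta>. c \<bullet> \<eta> = - e}"
  show "negligible ?N"
    using assms by (intro negligible_Union) (auto intro!: negligible_hyperplane)
  fix \<xi> :: 'a assume \<xi>: "\<xi> \<notin> ?N"
  have ex: "\<exists>U. open U \<and> \<xi> \<in> U \<and> (\<forall>\<eta>\<in>U. sgn (c \<bullet> \<eta> + e) = sgn (c \<bullet> \<xi> + e))" if "(c, e) \<in> H" for c e
  proof -
    have "(c = 0 \<and> e = 0) \<or> c \<bullet> \<xi> + e \<noteq> 0" using \<xi> that by force
    then consider "c = 0" "e = 0" | "0 < c \<bullet> \<xi> + e" | "c \<bullet> \<xi> + e < 0" by linarith
    then show ?thesis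
    proof cases
      case 1
      then show ?thesis by (intro exI[of _ UNIV]) auto
    next
      case 2
      then show ?thesis
        by (intro exI[of _ "{\<eta>. - e < c \<bullet> \<eta>}"]) (auto simp: open_halfspace_gt open_halfspace_lt)
    next
      case 3
      then show ?thesis
        by (intro exI[of _ "{\<eta>. c \<bullet> \<eta> < - e}"]) (auto simp: open_halfspace_gt open_halfspace_lt)
    qed
  qed
  then obtain U where U: "\<And>c e. (c, e) \<in> H \<Longrightarrow> open (U c e) \<and> \<xi> \<in> U c e \<and>
      (\<forall>\<eta>\<in>U c e. sgn (c \<bullet> \<eta> + e) = sgn (c \<bullet> \<xi> + e))"
    by metis
  show "\<exists>U. open U \<and> \<xi> \<in> U \<and> (\<forall>(c, e)\<in>H. \<forall>\<eta>\<in>U. sgn (c \<bullet> \<eta> + e) = sgn (c \<bullet> \<xi> + e))"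
  proof (intro exI[of _ "\<Inter>h\<in>H. U (fst h) (snd h)"] conjI)
    show "open (\<Inter>h\<in>H. U (fst h) (snd h))" using U assms by (intro open_INT) auto
    show "\<xi> \<in> (\<Inter>h\<in>H. U (fst h) (snd h))" using U by auto
    have "sgn (c \<bullet> \<eta> + e) = sgn (c \<bullet> \<xi> + e)" if "(c, e) \<in> H" "\<eta> \<in> (\<Inter>h\<in>H. U (fst h) (snd h))" for c e \<eta>
    proof -
      have "\<eta> \<in> U c e" using INT_D[OF that(2,1)] by (simp only: fst_conv snd_conv)
      then show ?thesis using U[OF that(1)] by blast
    qed
    then show "\<forall>(c, e)\<in>H. \<forall>\<eta>\<in>(\<Inter>h\<in>H. U (fst h) (snd h)). sgn (c \<bullet> \<eta> + e) = sgn (c \<bullet> \<xi> + e)"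
      by blast
  qed
qed

section \<open>The mean of an upper envelope of lines\<close>

text \<open>Differentiation under the integral sign for an integrand with kinks. The Lipschitz
  bounds dominate the difference quotients uniformly, so differentiability at almost every
  \<open>s\<close> suffices for dominated convergence along sequences.\<close>

lemma has_derivative_integral_AE:
  fixes \<phi> :: "'a::real_normed_vector \<Rightarrow> 's \<Rightarrow> real"
  assumes M: "finite_measure M"
    and int: "\<And>y. integrable M (\<phi> y)"
    and int': "\<And>h. integrable M (\<lambda>s. \<phi>' s h)"
    and lip: "\<And>y z s. \<bar>\<phi> y s - \<phi> z s\<bar> \<le> L * norm (y - z)"
    and lip': "\<And>s h. \<bar>\<phi>' s h\<bar> \<le> L * norm h"
    and lin: "\<And>s. linear (\<phi>' s)"
    and der: "AE s in M. ((\<lambda>y. \<phi> y s) has_derivative \<phi>' s) (at x)"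
  shows "((\<lambda>y. LINT s|M. \<phi> y s) has_derivative (\<lambda>h. LINT s|M. \<phi>' s h)) (at x)"
proof -
  interpret finite_measure M by fact
  let ?q = "\<lambda>y s. (\<phi> y s - \<phi> x s - \<phi>' s (y - x)) /\<^sub>R norm (y - x)"
  have q: "\<bar>?q y s\<bar> \<le> 2 * L" if "y \<noteq> x" for y s
  proof -
    have "\<bar>\<phi> y s - \<phi> x s - \<phi>' s (y - x)\<bar> \<le> 2 * L * norm (y - x)"
      using lip[of y s x] lip'[of s "y - x"] by linarith
    then show ?thesis using that by (simp add: abs_mult divide_simps)
  qed
  have linD: "linear (\<lambda>h. LINT s|M. \<phi>' s h)"
    by (rule linearI) (simp_all add: linear_add[OF lin] linear_scale[OF lin] int')
  have "bounded_linear (\<lambda>h. LINT s|M. \<phi>' s h)"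
  proof (rule bounded_linear.intro[OF linD], unfold_locales, intro exI allI)
    fix h
    have "norm (LINT s|M. \<phi>' s h) \<le> (LINT s|M. norm (\<phi>' s h))" by (rule integral_norm_bound)
    also have "\<dots> \<le> (LINT s|M. L * norm h)"
      using lip' by (intro integral_mono integrable_norm int') auto
    finally have "norm (LINT s|M. \<phi>' s h) \<le> (LINT s|M. L * norm h)" .
    then show "norm (LINT s|M. \<phi>' s h) \<le> norm h * (L * measure M (space M))"
      by (simp add: ac_simps)
  qed
  moreover have "((\<lambda>y. norm ((LINT s|M. \<phi> y s) - (LINT s|M. \<phi> x s) - (LINT s|M. \<phi>' s (y - x)))
      / norm (y - x)) \<longlongrightarrow> 0) (at x)"
    unfolding tendsto_at_iff_sequentially
  proof (intro allI impI)
    fix Y :: "nat \<Rightarrow> 'a" assume Y: "\<forall>i. Y i \<in> UNIV - {x}" "Y \<longlonglongrightarrow> x"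
    have "(\<lambda>i. LINT s|M. ?q (Y i) s) \<longlonglongrightarrow> (LINT s|M. 0)"
    proof (rule integral_dominated_convergence[where w = "\<lambda>_. 2 * L"])
      show "AE s in M. (\<lambda>i. ?q (Y i) s) \<longlonglongrightarrow> 0"
        using der
      proof eventually_elim
        case (elim s)
        have "((\<lambda>y. ?q y s) \<longlongrightarrow> 0) (at x)" using elim unfolding has_derivative_at_within by simp
        then show ?case using Y unfolding tendsto_at_iff_sequentially by (simp add: comp_def)
      qed
      show "AE s in M. norm (?q (Y i) s) \<le> 2 * L" for i using q[of "Y i"] Y(1) by simp
      show "(\<lambda>s. ?q (Y i) s) \<in> borel_measurable M" for i
        using borel_measurable_integrable[OF int] borel_measurable_integrable[OF int'] by measurable
    qed auto
    then have "(\<lambda>i. norm (LINT s|M. ?q (Y i) s)) \<longlonglongrightarrow> 0" by (intro tendsto_norm_zero) simp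
    moreover have "norm (LINT s|M. ?q (Y i) s) = norm ((LINT s|M. \<phi> (Y i) s) - (LINT s|M. \<phi> x s)
        - (LINT s|M. \<phi>' s (Y i - x))) / norm (Y i - x)" for i
      by (simp add: int int' abs_mult divide_inverse mult.commute)
    ultimately show "((\<lambda>y. norm ((LINT s|M. \<phi> y s) - (LINT s|M. \<phi> x s) - (LINT s|M. \<phi>' s (y - x)))
      / norm (y - x)) \<circ> Y) \<longlonglongrightarrow> 0" by (simp add: comp_def)
  qed
  ultimately show ?thesis unfolding has_derivative_iff_norm by blast
qed

text \<open>What the projection needs, freed from the polyhedral geometry: as a function of
  \<open>s\<close>, line \<open>v\<close> has slope \<open>m v\<close> and an intercept affine in
  the parameter \<open>\<eta>\<close>. The assumption \<open>unique\<close> is the form in which the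
  geometric condition enters.\<close>

locale line_envelope =
  fixes V :: "'v set" and m d :: "'v \<Rightarrow> real" and b :: "'v \<Rightarrow> 'a::euclidean_space"
    and \<rho> :: "real \<Rightarrow> real"
  assumes fin: "finite V" and ne: "V \<noteq> {}"
    and dens: "continuous_prob_density \<rho>"
    and moment: "integrable lborel (\<lambda>s. s * \<rho> s)"
    and unique: "\<And>\<eta>. AE s in lborel.
      \<exists>v\<in>V. \<forall>w\<in>V - {v}. m w * s + b w \<bullet> \<eta> + d w < m v * s + b v \<bullet> \<eta> + d v"
begin

definition line :: "'v \<Rightarrow> 'a \<Rightarrow> real \<Rightarrow> real" where
  "line v \<eta> s = m v * s + b v \<bullet> \<eta> + d v"

definition env :: "'a \<Rightarrow> real \<Rightarrow> real" where
  "env \<eta> s = Max ((\<lambda>v. line v \<eta> s) ` V)"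

definition \<mu> :: "real measure" where
  "\<mu> = density lborel (\<lambda>s. ennreal (\<rho> s))"

definition strict :: "'v \<Rightarrow> 'a \<Rightarrow> real set" where
  "strict v \<eta> = {s. \<forall>w\<in>V - {v}. line w \<eta> s < line v \<eta> s}"

definition weight :: "'v \<Rightarrow> 'a \<Rightarrow> real" where
  "weight v \<eta> = measure \<mu> (strict v \<eta>)"

definition mean_env :: "'a \<Rightarrow> real" where
  "mean_env \<eta> = (LINT s|lborel. env \<eta> s * \<rho> s)"

lemma density_facts:
  "\<rho> \<in> borel_measurable borel" "0 \<le> \<rho> t" "continuous_on UNIV \<rho>" "integrable lborel \<rho>"
  "(LINT t|lborel. \<rho> t) = 1"
  using dens by (auto simp: continuous_prob_density_def intro: borel_measurable_continuous_onI)

lemma [measurable]: "\<rho> \<in> borel_measurable borel" by (rule density_facts)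

lemma sets_\<mu> [measurable_cong, simp]: "sets \<mu> = sets borel" "space \<mu> = UNIV"
  by (simp_all add: \<mu>_def)

sublocale \<mu>: real_distribution \<mu>
proof (rule real_distribution.intro)
  have "(\<integral>\<^sup>+ s. ennreal (\<rho> s) \<partial>lborel) = 1"
    using density_facts by (simp add: nn_integral_eq_integral)
  then show "prob_space \<mu>" unfolding \<mu>_def
    by (intro prob_spaceI) (simp add: emeasure_density)
qed (simp_all add: real_distribution_axioms_def)

lemma integrable_\<mu>_iff:
  "g \<in> borel_measurable borel \<Longrightarrow> integrable \<mu> g \<longleftrightarrow> integrable lborel (\<lambda>s. \<rho> s * g s)"
  unfolding \<mu>_def by (subst integrable_density) (auto simp: density_facts)

lemma integral_\<mu>:
  "g \<in> borel_measurable borel \<Longrightarrow> (LINT s|\<mu>. g s) = (LINT s|lborel. \<rho> s * g s)"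
  unfolding \<mu>_def by (subst integral_density) (auto simp: density_facts)

lemma AE_\<mu>: "(AE s in lborel. Q s) \<Longrightarrow> AE s in \<mu>. Q s"
  unfolding \<mu>_def by (subst AE_density) auto

lemma line_measurable [measurable]: "line v \<eta> \<in> borel_measurable borel"
  unfolding line_def by measurable

lemma strict_measurable [measurable]: "strict v \<eta> \<in> sets borel"
proof -
  have "strict v \<eta> = (\<Inter>w\<in>V - {v}. {s \<in> space borel. line w \<eta> s < line v \<eta> s})"
    by (auto simp: strict_def)
  then show ?thesis using fin by (cases "V - {v} = {}") (auto intro!: sets.finite_INT)
qed

lemma env_measurable [measurable]: "env \<eta> \<in> borel_measurable borel"
  unfolding env_def using fin by measurable

lemma line_le_env: "v \<in> V \<Longrightarrow> line v \<eta> s \<le> env \<eta> s"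
  unfolding env_def using fin by simp

lemma env_attained: obtains v where "v \<in> V" "env \<eta> s = line v \<eta> s"
proof -
  have "env \<eta> s \<in> (\<lambda>v. line v \<eta> s) ` V"
    unfolding env_def using fin ne by (intro Max_in) auto
  then show thesis using that by blast
qed

lemma env_eq_strict:
  assumes "v \<in> V" "s \<in> strict v \<eta>"
  shows "env \<eta> s = line v \<eta> s"
proof -
  obtain w where "w \<in> V" "env \<eta> s = line w \<eta> s" by (rule env_attained)
  then show ?thesis using assms line_le_env[OF assms(1), of \<eta> s]
    by (cases "w = v") (force simp: strict_def dest: bspec[of _ _ w])+
qed

lemma line_diff: "line v y s - line v z s = b v \<bullet> (y - z)"
  by (simp add: line_def inner_diff_right)

lemma norm_le_sum: "v \<in> V \<Longrightarrow> norm (b v) \<le> (\<Sum>v\<in>V. norm (b v))"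
  using fin by (intro member_le_sum) auto

text \<open>The line active at \<open>y\<close> bounds the envelope from below at \<open>z\<close>,
  so the difference is at most that line's increment.\<close>

lemma env_diff_le: "env y s - env z s \<le> (\<Sum>v\<in>V. norm (b v)) * norm (y - z)"
proof -
  obtain v where v: "v \<in> V" "env y s = line v y s" by (rule env_attained)
  have "env y s - env z s \<le> b v \<bullet> (y - z)"
    using v line_le_env[OF v(1), of z s] line_diff[of v y s z] by simp
  also have "\<dots> \<le> norm (b v) * norm (y - z)" by (rule norm_cauchy_schwarz)
  also have "\<dots> \<le> (\<Sum>v\<in>V. norm (b v)) * norm (y - z)"
    by (intro mult_right_mono norm_le_sum v) simp
  finally show ?thesis .
qed

lemma env_lipschitz: "\<bar>env y s - env z s\<bar> \<le> (\<Sum>v\<in>V. norm (b v)) * norm (y - z)"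
  using env_diff_le[of y s z] env_diff_le[of z s y] by (simp add: norm_minus_commute abs_le_iff)

text \<open>The envelope is dominated by the sum of the absolute values of the lines, integrable by
  the first moment.\<close>

lemma integrable_env: "integrable \<mu> (env \<eta>)"
proof (rule Bochner_Integration.integrable_bound)
  have "integrable \<mu> (\<lambda>s. s)"
    using moment by (subst integrable_\<mu>_iff) (simp_all add: mult.commute)
  then show "integrable \<mu> (\<lambda>s. \<Sum>v\<in>V. \<bar>line v \<eta> s\<bar>)"
    unfolding line_def by (intro Bochner_Integration.integrable_sum integrable_abs
      Bochner_Integration.integrable_add integrable_mult_right) auto
  have "\<bar>env \<eta> s\<bar> \<le> (\<Sum>v\<in>V. \<bar>line v \<eta> s\<bar>)" for s
  proof -
    obtain v where v: "v \<in> V" "env \<eta> s = line v \<eta> s" by (rule env_attained)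
    show ?thesis unfolding v(2) by (rule member_le_sum[OF v(1)]) (auto simp: fin)
  qed
  then show "AE s in \<mu>. norm (env \<eta> s) \<le> norm (\<Sum>v\<in>V. \<bar>line v \<eta> s\<bar>)"
    by (auto intro!: AE_I2 abs_ge_self[THEN order_trans[rotated]])
qed measurable

lemma mean_env_eq: "mean_env \<eta> = (LINT s|\<mu>. env \<eta> s)"
  by (simp add: integral_\<mu> mean_env_def mult.commute)

text \<open>Finitely many strict inequalities between continuous functions of \<open>y\<close>
  persist near \<open>\<eta>\<close>.\<close>

lemma eventually_strict:
  assumes "v \<in> V" "s \<in> strict v \<eta>"
  shows "\<forall>\<^sub>F y in nhds \<eta>. s \<in> strict v y"
proof -
  have "\<forall>\<^sub>F y in nhds \<eta>. line w y s < line v y s" if "w \<in> V - {v}" for w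
  proof (rule order_tendstoD(1)[where y = "line v \<eta> s - line w \<eta> s" and f = "\<lambda>y. line v y s - line w y s" and a = 0, simplified])
    show "((\<lambda>y. line v y s - line w y s) \<longlongrightarrow> line v \<eta> s - line w \<eta> s) (nhds \<eta>)"
      unfolding line_def by (intro tendsto_intros filterlim_ident)
    show "line w \<eta> s < line v \<eta> s" using assms that by (simp add: strict_def)
  qed
  then have "\<forall>\<^sub>F y in nhds \<eta>. \<forall>w\<in>V - {v}. line w y s < line v y s"
    using fin by (intro eventually_ball_finite) auto
  then show ?thesis by (simp add: strict_def)
qed

lemma strict_disjoint: "v \<in> V \<Longrightarrow> w \<in> V \<Longrightarrow> s \<in> strict v \<eta> \<Longrightarrow> s \<in> strict w \<eta> \<Longrightarrow> v = w"
  unfolding strict_def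
  by (metis (mono_tags, lifting) Diff_iff less_asym mem_Collect_eq singletonD)

lemma AE_strict: "AE s in \<mu>. \<exists>v\<in>V. s \<in> strict v \<eta>"
  using AE_\<mu>[OF unique[of \<eta>]] by (simp add: strict_def line_def)

text \<open>Where line \<open>v\<close> is strictly active it coincides with the envelope for all
  nearby parameters, so the envelope has gradient \<open>b v\<close> there. This covers almost every
  \<open>s\<close>.\<close>

lemma has_derivative_mean_env:
  "(mean_env has_derivative (\<lambda>h. \<Sum>v\<in>V. weight v \<eta> * (b v \<bullet> h))) (at \<eta>)"
proof -
  \<comment> \<open>Writing the gradient with indicators covers all vertices at once; integrating
    over \<open>s\<close> turns each indicator into a weight.\<close>
  let ?D = "\<lambda>s h. \<Sum>v\<in>V. indicator (strict v \<eta>) s * (b v \<bullet> h)"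
  let ?L = "\<Sum>v\<in>V. norm (b v)"
  have int: "integrable \<mu> (indicator (strict v \<eta>) :: real \<Rightarrow> real)" for v
    by (simp add: \<mu>.emeasure_eq_measure)
  have "((\<lambda>y. LINT s|\<mu>. env y s) has_derivative (\<lambda>h. LINT s|\<mu>. ?D s h)) (at \<eta>)"
  proof (rule has_derivative_integral_AE[where L = ?L])
    show "finite_measure \<mu>" by unfold_locales
    show "integrable \<mu> (\<lambda>s. ?D s h)" for h
      by (intro Bochner_Integration.integrable_sum integrable_mult_left int)
    show "\<bar>?D s h\<bar> \<le> ?L * norm h" for s h
    proof -
      have "\<bar>?D s h\<bar> \<le> (\<Sum>v\<in>V. \<bar>indicator (strict v \<eta>) s * (b v \<bullet> h)\<bar>)" by (rule sum_abs)
      also have "\<dots> \<le> (\<Sum>v\<in>V. norm (b v) * norm h)"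
        by (intro sum_mono) (auto simp: abs_mult indicator_def Cauchy_Schwarz_ineq2)
      finally show ?thesis by (simp add: sum_distrib_right)
    qed
    show "linear (?D s)" for s
      by (intro linear_compose_sum ballI linearI) (simp_all add: inner_add_right distrib_left)
    have "((\<lambda>y. env y s) has_derivative ?D s) (at \<eta>)" if "\<exists>v\<in>V. s \<in> strict v \<eta>" for s
    proof -
      from that obtain v where v: "v \<in> V" "s \<in> strict v \<eta>" by blast
      have sum: "?D s h = (\<Sum>u\<in>V. if u = v then b v \<bullet> h else 0)" for h
        using strict_disjoint[OF v(1) _ v(2)] v(2)
        by (intro sum.cong refl) (metis indicator_simps mult_1 mult_zero_left)
      then have D: "?D s = (\<lambda>h. b v \<bullet> h)" unfolding sum using fin v(1) by simp
      have "((\<lambda>y. line v y s) has_derivative (\<lambda>h. b v \<bullet> h)) (at \<eta>)"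
        unfolding line_def by (auto intro!: derivative_eq_intros)
      moreover have "\<forall>\<^sub>F y in at \<eta>. line v y s = env y s"
        using filter_leD[OF at_within_le_nhds eventually_strict[OF v]]
        by eventually_elim (simp add: env_eq_strict[OF v(1)])
      ultimately show ?thesis unfolding D
        by (rule has_derivative_transform_eventually) (simp_all add: env_eq_strict[OF v])
    qed
    then show "AE s in \<mu>. ((\<lambda>y. env y s) has_derivative ?D s) (at \<eta>)"
      using AE_strict[of \<eta>] by (auto elim!: AE_mp)
  qed (use integrable_env env_lipschitz in auto)
  moreover have "(LINT s|\<mu>. ?D s h) = (\<Sum>v\<in>V. weight v \<eta> * (b v \<bullet> h))" for h
    using int by (simp add: weight_def)
  ultimately show ?thesis by (simp add: mean_env_eq[abs_def])
qed

text \<open>For almost every \<open>s\<close> some line \<open>u\<close> is strictly active at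
  \<open>\<eta>\<close> and remains so nearby. Strict activity is exclusive, so the indicator of
  \<open>strict v\<close> is eventually constant along the sequence, and dominated convergence
  applies.\<close>

lemma continuous_weight: "v \<in> V \<Longrightarrow> continuous_on UNIV (weight v)"
proof (simp add: continuous_on_eq_continuous_at continuous_at_sequentially, intro allI impI)
  fix \<eta> :: 'a and Y :: "nat \<Rightarrow> 'a" assume v: "v \<in> V" and Y: "Y \<longlonglongrightarrow> \<eta>"
  have eq: "weight v y = (LINT s|\<mu>. indicator (strict v y) s)" for y
    by (simp add: weight_def)
  show "(weight v \<circ> Y) \<longlonglongrightarrow> weight v \<eta>"
    unfolding comp_def eq
  proof (rule integral_dominated_convergence[where w = "\<lambda>_. 1"])
    show "AE s in \<mu>. (\<lambda>i. indicator (strict v (Y i)) s :: real) \<longlonglongrightarrow> indicator (strict v \<eta>) s"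
      using AE_strict[of \<eta>]
    proof eventually_elim
      case (elim s)
      then obtain u where u: "u \<in> V" "s \<in> strict u \<eta>" by blast
      have "\<forall>\<^sub>F i in sequentially. s \<in> strict u (Y i)"
        using eventually_strict[OF u] Y unfolding filterlim_iff by blast
      then have "\<forall>\<^sub>F i in sequentially.
          (indicator (strict v (Y i)) s :: real) = indicator (strict v \<eta>) s"
        by eventually_elim (use u v strict_disjoint in \<open>fastforce simp: indicator_def\<close>)
      then show ?case by (rule tendsto_eventually)
    qed
  qed (auto simp: indicator_def)
qed

section \<open>The distribution function and the probabilities of intervals\<close>

lemma measure_\<mu>: "A \<in> sets borel \<Longrightarrow> measure \<mu> A = (LINT s:A|lborel. \<rho> s)"
proof -
  assume [measurable]: "A \<in> sets borel"
  have "measure \<mu> A = (LINT s|\<mu>. indicator A s)" by simp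
  also have "\<dots> = (LINT s:A|lborel. \<rho> s)"
    by (subst integral_\<mu>) (auto simp: set_lebesgue_integral_def mult.commute)
  finally show ?thesis .
qed

text \<open>Fundamental theorem of calculus for the continuous \<open>\<rho>\<close>; anchoring at
  \<open>t - 1\<close> makes \<open>cdf \<mu>\<close>, near \<open>t\<close>, a constant plus an
  integral over a compact interval.\<close>

lemma DERIV_cdf: "(cdf \<mu> has_real_derivative \<rho> t) (at t)"
proof -
  let ?a = "t - 1"
  have eq: "cdf \<mu> x = cdf \<mu> ?a + integral {?a..x} \<rho>" if "?a < x" for x
  proof -
    have "cdf \<mu> x - cdf \<mu> ?a = (LINT s:{?a<..x}|lborel. \<rho> s)"
      using \<mu>.cdf_diff_eq[OF that] by (simp add: measure_\<mu>)
    also have "\<dots> = integral {?a<..x} \<rho>"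
    proof (rule set_borel_integral_eq_integral(2))
      show "set_integrable lborel {?a<..x} \<rho>"
        unfolding set_integrable_def using density_facts(4) by (intro integrable_mult_indicator) auto
    qed
    also have "\<dots> = integral {?a..x} \<rho>"
      by (rule integral_spike_set) (auto intro: negligible_subset[of "{?a}"])
    finally show ?thesis by simp
  qed
  have "((\<lambda>x. cdf \<mu> ?a + integral {?a..x} \<rho>) has_real_derivative 0 + \<rho> t) (at t within {?a..t + 1})"
    by (intro DERIV_add DERIV_const integral_has_real_derivative)
      (auto intro: continuous_on_subset[OF density_facts(3)])
  then have "((\<lambda>x. cdf \<mu> ?a + integral {?a..x} \<rho>) has_real_derivative \<rho> t) (at t)"
    using at_within_Icc_at[of ?a t "t + 1"] by simp
  then show ?thesis
    by (rule has_field_derivative_transform_within_open[of _ _ _ "{?a<..}"]) (auto simp: eq)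
qed

lemma measure_intervals:
  "measure \<mu> {..<x} = cdf \<mu> x"
  "measure \<mu> {x<..} = 1 - cdf \<mu> x"
  "x < y \<Longrightarrow> measure \<mu> {x<..<y} = cdf \<mu> y - cdf \<mu> x"
proof -
  \<comment> \<open>Single points carry no mass because \<open>\<mu>\<close> has a density.\<close>
  have lt: "measure \<mu> {..<x} = cdf \<mu> x" for x
  proof -
    have "measure \<mu> {x} = 0"
      by (subst measure_\<mu>)
         (auto simp: set_lebesgue_integral_def indicator_def intro!: integral_eq_zero_AE AE_I[where N = "{x}"])
    moreover have "measure \<mu> ({..<x} \<union> {x}) = measure \<mu> {..<x} + measure \<mu> {x}"
      by (rule \<mu>.finite_measure_Union) auto
    ultimately show ?thesis by (simp add: cdf_def ivl_disj_un(2)[symmetric] del: Un_insert_right)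
  qed
  then show "measure \<mu> {..<x} = cdf \<mu> x" .
  have "measure \<mu> (space \<mu> - {..x}) = 1 - measure \<mu> {..x}" by (rule \<mu>.prob_compl) simp
  moreover have "space \<mu> - {..x} = {x<..}" by auto
  ultimately show "measure \<mu> {x<..} = 1 - cdf \<mu> x" by (simp add: cdf_def)
  assume "x < y"
  then have "measure \<mu> ({..<y} - {..x}) = measure \<mu> {..<y} - measure \<mu> {..x}"
    by (intro \<mu>.finite_measure_Diff) auto
  moreover have "{..<y} - {..x} = {x<..<y}" by auto
  ultimately show "measure \<mu> {x<..<y} = cdf \<mu> y - cdf \<mu> x" using lt by (simp add: cdf_def)
qed

end

text \<open>Line \<open>v\<close> beats flatter lines to the right of their crossing and steeper
  ones to the left of it; against parallel lines the comparison does not involve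
  \<open>s\<close>.\<close>

lemma (in line_envelope) strict_eq:
  "strict v \<eta> = {s. (\<forall>w\<in>V. m w < m v \<longrightarrow> (b w - b v) \<bullet> \<eta> / (m v - m w) + (d w - d v) / (m v - m w) < s) \<and>
    (\<forall>w\<in>V. m v < m w \<longrightarrow> s < (b w - b v) \<bullet> \<eta> / (m v - m w) + (d w - d v) / (m v - m w)) \<and>
    (\<forall>w\<in>V - {v}. m w = m v \<longrightarrow> (b w - b v) \<bullet> \<eta> + (d w - d v) < 0)}"
proof -
  have "line w \<eta> s < line v \<eta> s \<longleftrightarrow>
    (m w < m v \<longrightarrow> (b w - b v) \<bullet> \<eta> / (m v - m w) + (d w - d v) / (m v - m w) < s) \<and>
    (m v < m w \<longrightarrow> s < (b w - b v) \<bullet> \<eta> / (m v - m w) + (d w - d v) / (m v - m w)) \<and>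
    (m w = m v \<longrightarrow> (b w - b v) \<bullet> \<eta> + (d w - d v) < 0)" for w s
  proof (cases "m w" "m v" rule: linorder_cases)
    case less
    then show ?thesis
      by (simp add: line_def inner_diff_left pos_divide_less_eq algebra_simps flip: add_divide_distrib)
  next
    case greater
    then show ?thesis
      by (simp add: line_def inner_diff_left neg_less_divide_eq algebra_simps flip: add_divide_distrib)
  qed (auto simp: line_def inner_diff_left)
  note key = this
  show ?thesis unfolding strict_def key ball_conj_distrib
    by (intro Collect_cong arg_cong2[where f = conj]) auto
qed

text \<open>Off finitely many hyperplanes the crossing points of the lines keep their order, so that
  \<open>strict v\<close> is locally an interval whose endpoints are affine in the parameter.\<close>

lemma weight_locally_smooth:
  fixes V :: "'v set" and b :: "'v \<Rightarrow> real ^ 'd::finite"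
  assumes env: "line_envelope V m d b \<rho>" and \<rho>: "C_real n \<rho>"
  obtains N where "negligible N" "\<And>\<xi>. \<xi> \<notin> N \<Longrightarrow>
    \<exists>U. open U \<and> \<xi> \<in> U \<and> (\<forall>v\<in>V. smooth_on U (Suc n) (line_envelope.weight V m d b \<rho> v))"
proof -
  interpret line_envelope V m d b \<rho> by fact
  \<comment> \<open>Coefficients of the crossing point of lines \<open>v\<close> and
    \<open>w\<close> as an affine function of \<open>\<eta>\<close>. For equal slopes division by
    zero gives 0; \<open>L\<close> and \<open>R\<close> below contain no such
    \<open>w\<close>.\<close>
  define cb where "cb v w = (b w - b v) /\<^sub>R (m v - m w)" for v w
  define cd where "cd v w = (d w - d v) / (m v - m w)" for v w
  define cross where "cross v w \<eta> = cb v w \<bullet> \<eta> + cd v w" for v w \<eta>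
  \<comment> \<open>Signs of the first family decide between parallel lines; signs of the second
    order the crossing points on line \<open>v\<close>.\<close>
  define H where "H = (\<lambda>(v, w). (b w - b v, d w - d v)) ` (V \<times> V) \<union>
    (\<lambda>(v, w, u). (cb v w - cb v u, cd v w - cd v u)) ` (V \<times> V \<times> V)"
  have "finite H" unfolding H_def using fin by simp
  then obtain N where N: "negligible N" "\<And>\<xi>. \<xi> \<notin> N \<Longrightarrow>
    \<exists>U. open U \<and> \<xi> \<in> U \<and> (\<forall>(c, e)\<in>H. \<forall>\<eta>\<in>U. sgn (c \<bullet> \<eta> + e) = sgn (c \<bullet> \<xi> + e))"
    by (rule affine_sign_locally_constant) blast
  have C: "C_real (Suc n) (cdf \<mu>)" using C_real_SucI[OF DERIV_cdf \<rho>] .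
  have "smooth_on U (Suc n) (weight v)"
    if U: "open U" "\<xi> \<in> U" and sgn: "\<forall>(c, e)\<in>H. \<forall>\<eta>\<in>U. sgn (c \<bullet> \<eta> + e) = sgn (c \<bullet> \<xi> + e)"
      and v: "v \<in> V" for \<xi> U v
  proof -
    have ridge: "smooth_on U (Suc n) (\<lambda>\<eta>. cdf \<mu> (cross v w \<eta>))" for w
      unfolding cross_def by (rule smooth_on_ridge[OF U(1) C])
    have const: "smooth_on U (Suc n) (\<lambda>_. c)" for c by (rule smooth_on_const[OF U(1)])
    have diff: "smooth_on U (Suc n) (\<lambda>\<eta>. F \<eta> - G \<eta>)"
      if "smooth_on U (Suc n) F" "smooth_on U (Suc n) G" for F G
      using smooth_on_add[OF U(1) that(1) smooth_on_cmult[OF U(1) that(2), of "- 1"]]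
      by (simp del: smooth_on.simps)
    have cong: "smooth_on U (Suc n) (weight v)"
      if "smooth_on U (Suc n) F" "\<And>\<eta>. \<eta> \<in> U \<Longrightarrow> weight v \<eta> = F \<eta>" for F
      by (rule smooth_on_cong[OF U(1) that(1)]) (simp add: that(2))
    have sgnH: "sgn (c \<bullet> \<eta> + e) = sgn (c \<bullet> \<xi> + e)" if "(c, e) \<in> H" "\<eta> \<in> U" for c e \<eta>
      using sgn that by blast
    have less: "cross v w \<eta> < cross v u \<eta> \<longleftrightarrow> cross v w \<xi> < cross v u \<xi>"
      if "w \<in> V" "u \<in> V" "\<eta> \<in> U" for w u \<eta>
    proof -
      have "(cb v w - cb v u, cd v w - cd v u) \<in> H" using v that unfolding H_def by force
      from sgnH[OF this that(3)] have "sgn (cross v w \<eta> - cross v u \<eta>) = sgn (cross v w \<xi> - cross v u \<xi>)"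
        by (simp add: cross_def inner_diff_left algebra_simps)
      then show ?thesis by (simp add: sgn_if split: if_splits)
    qed
    have neg: "(b w - b v) \<bullet> \<eta> + (d w - d v) < 0 \<longleftrightarrow> (b w - b v) \<bullet> \<xi> + (d w - d v) < 0"
      if "w \<in> V" "\<eta> \<in> U" for w \<eta>
    proof -
      have "(b w - b v, d w - d v) \<in> H" using v that unfolding H_def by force
      from sgnH[OF this that(2)] show ?thesis by (simp add: sgn_if split: if_splits)
    qed
    define L where "L = {w \<in> V. m w < m v}"
    define R where "R = {w \<in> V. m v < m w}"
    have LR: "finite L" "finite R" "L \<subseteq> V" "R \<subseteq> V" using fin by (auto simp: L_def R_def)
    have strict': "strict v \<eta> = {s. (\<forall>w\<in>L. cross v w \<eta> < s) \<and> (\<forall>w\<in>R. s < cross v w \<eta>) \<and>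
      (\<forall>w\<in>V - {v}. m w = m v \<longrightarrow> (b w - b v) \<bullet> \<xi> + (d w - d v) < 0)}" if "\<eta> \<in> U" for \<eta>
      unfolding strict_eq cross_def cb_def cd_def L_def R_def
      using neg[OF _ that] by (auto simp: divide_inverse mult.commute)
    show ?thesis
    proof (cases "\<forall>w\<in>V - {v}. m w = m v \<longrightarrow> (b w - b v) \<bullet> \<xi> + (d w - d v) < 0")
      case False
      then have "strict v \<eta> = {}" if "\<eta> \<in> U" for \<eta>
        unfolding strict'[OF that] by blast
      then have "weight v \<eta> = 0" if "\<eta> \<in> U" for \<eta>
        using that by (simp add: weight_def)
      then show ?thesis by (rule cong[OF const])
    next
      case True
      then have S: "strict v \<eta> = {s. (\<forall>w\<in>L. cross v w \<eta> < s) \<and> (\<forall>w\<in>R. s < cross v w \<eta>)}" if "\<eta> \<in> U" for \<eta>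
        using strict'[OF that] by simp
      \<comment> \<open>The crossing that is largest at \<open>\<xi>\<close> stays largest on all of
        \<open>U\<close>, so one \<open>u\<close> gives the left endpoint throughout.\<close>
      have lo: "\<exists>u\<in>L. \<forall>\<eta>\<in>U. \<forall>s. (\<forall>w\<in>L. cross v w \<eta> < s) \<longleftrightarrow> cross v u \<eta> < s" if ne: "L \<noteq> {}"
      proof -
        obtain u where u: "u \<in> L" "\<And>w. w \<in> L \<Longrightarrow> \<not> cross v u \<xi> < cross v w \<xi>"
          using arg_min_if_finite[OF LR(1) ne, of "\<lambda>w. - cross v w \<xi>"] by fastforce
        then have "cross v w \<eta> \<le> cross v u \<eta>" if "w \<in> L" "\<eta> \<in> U" for w \<eta>
          using less[of u w \<eta>] that LR(3) by (meson not_less subsetD)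
        then show ?thesis using u(1) by (intro bexI[of _ u]) (auto intro: le_less_trans)
      qed
      have hi: "\<exists>u\<in>R. \<forall>\<eta>\<in>U. \<forall>s. (\<forall>w\<in>R. s < cross v w \<eta>) \<longleftrightarrow> s < cross v u \<eta>" if ne: "R \<noteq> {}"
      proof -
        obtain u where u: "u \<in> R" "\<And>w. w \<in> R \<Longrightarrow> \<not> cross v w \<xi> < cross v u \<xi>"
          using arg_min_if_finite[OF LR(2) ne, of "\<lambda>w. cross v w \<xi>"] by fastforce
        then have "cross v u \<eta> \<le> cross v w \<eta>" if "w \<in> R" "\<eta> \<in> U" for w \<eta>
          using less[of w u \<eta>] that LR(4) by (meson not_less subsetD)
        then show ?thesis using u(1) by (intro bexI[of _ u]) (auto intro: less_le_trans)
      qed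
      consider "L = {}" "R = {}" | "L = {}" "R \<noteq> {}" | "L \<noteq> {}" "R = {}" | "L \<noteq> {}" "R \<noteq> {}" by blast
      then show ?thesis
      proof cases
        case 1
        then have "weight v \<eta> = 1" if "\<eta> \<in> U" for \<eta>
          using \<mu>.prob_space unfolding weight_def S[OF that] by simp
        then show ?thesis by (rule cong[OF const])
      next
        case 2
        then obtain u where u: "\<forall>\<eta>\<in>U. \<forall>s. (\<forall>w\<in>R. s < cross v w \<eta>) \<longleftrightarrow> s < cross v u \<eta>" using hi by blast
        have "weight v \<eta> = cdf \<mu> (cross v u \<eta>)" if "\<eta> \<in> U" for \<eta>
        proof -
          have "strict v \<eta> = {..<cross v u \<eta>}" unfolding S[OF that] using u that 2 by auto
          then show ?thesis by (simp add: weight_def measure_intervals)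
        qed
        then show ?thesis by (rule cong[OF ridge])
      next
        case 3
        then obtain u where u: "\<forall>\<eta>\<in>U. \<forall>s. (\<forall>w\<in>L. cross v w \<eta> < s) \<longleftrightarrow> cross v u \<eta> < s" using lo by blast
        have "weight v \<eta> = 1 - cdf \<mu> (cross v u \<eta>)" if "\<eta> \<in> U" for \<eta>
        proof -
          have "strict v \<eta> = {cross v u \<eta><..}" unfolding S[OF that] using u that 3 by auto
          then show ?thesis by (simp add: weight_def measure_intervals)
        qed
        then show ?thesis by (rule cong[OF diff[OF const ridge]])
      next
        case 4
        then obtain u where u: "u \<in> L" "\<forall>\<eta>\<in>U. \<forall>s. (\<forall>w\<in>L. cross v w \<eta> < s) \<longleftrightarrow> cross v u \<eta> < s" using lo by blast
        obtain u' where u': "u' \<in> R" "\<forall>\<eta>\<in>U. \<forall>s. (\<forall>w\<in>R. s < cross v w \<eta>) \<longleftrightarrow> s < cross v u' \<eta>" using hi 4 by blast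
        have s: "strict v \<eta> = {cross v u \<eta><..<cross v u' \<eta>}" if "\<eta> \<in> U" for \<eta>
          unfolding S[OF that] using u u' that by auto
        have less': "cross v u \<eta> < cross v u' \<eta> \<longleftrightarrow> cross v u \<xi> < cross v u' \<xi>" if "\<eta> \<in> U" for \<eta>
          using less[OF _ _ that] u(1) u'(1) LR by blast
        show ?thesis
        \<comment> \<open>The order of the endpoints at \<open>\<xi>\<close> decides whether the
          interval is nonempty on all of \<open>U\<close> or empty on all of it.\<close>
        proof (cases "cross v u \<xi> < cross v u' \<xi>")
          case True
          then have "weight v \<eta> = cdf \<mu> (cross v u' \<eta>) - cdf \<mu> (cross v u \<eta>)" if "\<eta> \<in> U" for \<eta>
            unfolding weight_def s[OF that] using less'[OF that] by (simp add: measure_intervals)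
          then show ?thesis by (rule cong[OF diff[OF ridge ridge]])
        next
          case False
          then have "weight v \<eta> = 0" if "\<eta> \<in> U" for \<eta>
            unfolding weight_def s[OF that] using less'[OF that] by simp
          then show ?thesis by (rule cong[OF const])
        qed
      qed
    qed
  qed
  then have "\<exists>U. open U \<and> \<xi> \<in> U \<and> (\<forall>v\<in>V. smooth_on U (Suc n) (weight v))" if "\<xi> \<notin> N" for \<xi>
    using N(2)[OF that] by blast
  with N(1) show thesis by (rule that)
qed

section \<open>The two-stage problem\<close>

text \<open>The component \<open>\<xi> $ k\<close> is bounded by the norm, and by Tonelli its
  absolute moment factors into the moment of \<open>\<rho> k\<close> and total masses equal to
  1.\<close>

lemma integrable_first_moment:
  fixes \<rho> :: "'d::finite \<Rightarrow> real \<Rightarrow> real" and k :: 'd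
  assumes dens: "\<forall>i. continuous_prob_density (\<rho> i)"
    and int: "integrable (density lborel (\<lambda>\<xi> :: real ^ 'd. ennreal (\<Prod>i\<in>UNIV. \<rho> i (\<xi> $ i)))) (\<lambda>\<xi>. norm \<xi>)"
  shows "integrable lborel (\<lambda>s. s * \<rho> k s)"
proof -
  have \<rho>: "\<rho> i \<in> borel_measurable borel" "0 \<le> \<rho> i t" "(\<integral>\<^sup>+ t. ennreal (\<rho> i t) \<partial>lborel) = 1" for i t
    using dens by (auto simp: continuous_prob_density_def nn_integral_eq_integral
      intro: borel_measurable_continuous_onI)
  note [measurable] = \<rho>(1)
  \<comment> \<open>Factors are indexed by basis vectors to fit the product formula for
    \<open>lborel\<close>; the one at \<open>axis k 1\<close> carries the extra
    \<open>\<bar>s\<bar>\<close>.\<close>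
  define f :: "real ^ 'd \<Rightarrow> real \<Rightarrow> ennreal" where
    "f b s = (if b = axis k 1 then ennreal (\<bar>s\<bar> * \<rho> k s) else ennreal (\<rho> (axis_index b) s))" for b s
  have idx: "axis_index (axis i (1::real)) = i" for i :: 'd
    by (simp add: axis_index_axis)
  have basis: "(\<Prod>b\<in>Basis. g b) = (\<Prod>i\<in>UNIV. g (axis i 1))" for g :: "real ^ 'd \<Rightarrow> ennreal"
  proof -
    have eq: "(Basis :: (real ^ 'd) set) = (\<lambda>i. axis i 1) ` UNIV" by (auto simp: Basis_vec_def)
    show ?thesis
      unfolding eq by (subst prod.reindex) (auto simp: inj_on_def axis_eq_axis)
  qed
  have split: "(\<Prod>i\<in>UNIV. g i) = g k * (\<Prod>i\<in>UNIV - {k}. g i)" for g :: "'d \<Rightarrow> ennreal"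
    by (rule prod.remove) auto
  have "(\<integral>\<^sup>+ s. ennreal (\<bar>s\<bar> * \<rho> k s) \<partial>lborel) = (\<Prod>i\<in>UNIV. \<integral>\<^sup>+ s. f (axis i 1) s \<partial>lborel)"
    unfolding split f_def by (simp add: axis_eq_axis idx \<rho>)
  also have "\<dots> = (\<Prod>b\<in>Basis. \<integral>\<^sup>+ s. f b s \<partial>lborel)" by (simp add: basis)
  also have "\<dots> = (\<integral>\<^sup>+ \<xi>. (\<Prod>b\<in>Basis. f b (\<xi> \<bullet> b)) \<partial>lborel)"
    by (rule nn_integral_lborel_prod[symmetric]) (auto simp: f_def)
  also have "\<dots> = (\<integral>\<^sup>+ \<xi>. ennreal (\<Prod>i\<in>UNIV. \<rho> i (\<xi> $ i)) * ennreal \<bar>\<xi> $ k\<bar> \<partial>lborel)"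
  proof (rule nn_integral_cong)
    fix \<xi> :: "real ^ 'd"
    have "(\<Prod>b\<in>Basis. f b (\<xi> \<bullet> b)) = ennreal (\<bar>\<xi> $ k\<bar> * \<rho> k (\<xi> $ k)) * (\<Prod>i\<in>UNIV - {k}. ennreal (\<rho> i (\<xi> $ i)))"
      unfolding basis split f_def by (simp add: axis_eq_axis idx cart_eq_inner_axis)
    also have "\<dots> = (\<Prod>i\<in>UNIV. ennreal (\<rho> i (\<xi> $ i))) * ennreal \<bar>\<xi> $ k\<bar>"
      unfolding split[of "\<lambda>i. ennreal (\<rho> i (\<xi> $ i))"] by (simp add: ennreal_mult \<rho> ac_simps)
    finally show "(\<Prod>b\<in>Basis. f b (\<xi> \<bullet> b)) = ennreal (\<Prod>i\<in>UNIV. \<rho> i (\<xi> $ i)) * ennreal \<bar>\<xi> $ k\<bar>"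
      by (simp add: prod_ennreal \<rho>)
  qed
  also have "\<dots> \<le> (\<integral>\<^sup>+ \<xi>. ennreal (\<Prod>i\<in>UNIV. \<rho> i (\<xi> $ i)) * ennreal (norm \<xi>) \<partial>lborel)"
    by (intro nn_integral_mono mult_left_mono ennreal_leI component_le_norm_cart) auto
  also have "\<dots> = (\<integral>\<^sup>+ \<xi>. ennreal (norm \<xi>)
      \<partial>density lborel (\<lambda>\<xi> :: real ^ 'd. ennreal (\<Prod>i\<in>UNIV. \<rho> i (\<xi> $ i))))"
    by (subst nn_integral_density) auto
  also have "\<dots> < \<infinity>" using int by (simp add: integrable_iff_bounded)
  finally have "(\<integral>\<^sup>+ s. ennreal (norm (s * \<rho> k s)) \<partial>lborel) < \<infinity>" by (simp add: abs_mult \<rho>)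
  then show ?thesis by (intro integrableI_bounded) auto
qed

section \<open>The dual polyhedron, its recession cone and its optimal faces\<close>

lemma dual_feasible_polyhedron: "polyhedron (dual_feasible W q)"
proof -
  have "dual_feasible W q = (\<Inter>i. {z. transpose W $ i \<bullet> z \<le> q $ i})"
    by (auto simp: dual_feasible_def less_eq_vec_def matrix_vector_mul_component simp del: transpose_matrix_vector)
  then show ?thesis by (auto intro!: polyhedron_Inter polyhedron_halfspace_le)
qed

lemma recession_cone_closed:
  "closed {b. transpose W *v b \<le> (0 :: real ^ 'n)}" for W :: "real ^ 'n ^ 'r"
proof -
  have "{b. transpose W *v b \<le> 0} = (\<Inter>i. {z. transpose W $ i \<bullet> z \<le> 0})"
    by (auto simp: less_eq_vec_def matrix_vector_mul_component simp del: transpose_matrix_vector)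
  then show ?thesis by (simp add: closed_INT closed_halfspace_le)
qed

lemma recession_cone_cone:
  "cone {b. transpose W *v b \<le> (0 :: real ^ 'n)}" for W :: "real ^ 'n ^ 'r"
  by (auto simp: cone_def less_eq_vec_def matrix_vector_mul_component mult_nonneg_nonpos
    simp del: transpose_matrix_vector)

text \<open>Writing \<open>t = W *v y\<close> moves \<open>W\<close> to the other factor, giving an
  inner product of a nonnegative and a nonpositive vector.\<close>

lemma pos_image_recession:
  assumes "t \<in> pos_image W" "transpose W *v b \<le> 0"
  shows "t \<bullet> b \<le> 0"
proof -
  obtain y where y: "t = W *v y" "0 \<le> y" using assms(1) by (auto simp: pos_image_def)
  have "t \<bullet> b = y \<bullet> (transpose W *v b)"
    unfolding y(1) by (metis dot_lmul_matrix inner_commute transpose_matrix_vector)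
  also have "\<dots> \<le> 0"
    unfolding inner_vec_def using y(2) assms(2)
    by (intro sum_nonpos) (auto simp: less_eq_vec_def mult_nonneg_nonpos
      simp del: transpose_matrix_vector)
  finally show ?thesis .
qed

text \<open>The functional \<open>t\<close> is nonpositive on the recession cone, so its maximum
  over \<open>D\<close> is attained at \<open>v\<close>. The optimal face contains \<open>v\<close>
  and \<open>w\<close>, hence an edge between two vertices, on which \<open>t\<close> is
  constant.\<close>

lemma active_vertices_adjacent:
  fixes W :: "real ^ 'n ^ 'r" and q :: "real ^ 'n"
  defines "D \<equiv> dual_feasible W q"
  assumes dec: "D = {a + b | a b. a \<in> convex hull (vertices D) \<and> transpose W *v b \<le> 0}"
    and t: "t \<in> pos_image W"
    and v: "v \<in> vertices D" "\<And>u. u \<in> vertices D \<Longrightarrow> u \<bullet> t \<le> v \<bullet> t"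
    and w: "w \<in> vertices D" "w \<noteq> v" "w \<bullet> t = v \<bullet> t"
  obtains v' w' where "adjacent D v' w'" "v' \<bullet> t = w' \<bullet> t"
proof -
  have le: "t \<bullet> z \<le> t \<bullet> v" if z: "z \<in> D" for z
  proof -
    obtain a b where ab: "z = a + b" "a \<in> convex hull (vertices D)" "transpose W *v b \<le> 0"
      using z dec by blast
    have "convex hull (vertices D) \<subseteq> {z. t \<bullet> z \<le> t \<bullet> v}"
      using v(2) by (intro hull_minimal convex_halfspace_le) (auto simp: inner_commute)
    then have "t \<bullet> a \<le> t \<bullet> v" using ab(2) by blast
    then show ?thesis using pos_image_recession[OF t ab(3)] by (simp add: ab(1) inner_add_right)
  qed
  have poly: "polyhedron D" unfolding D_def by (rule dual_feasible_polyhedron)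
  let ?F = "D \<inter> {z. t \<bullet> z = t \<bullet> v}"
  have F: "?F face_of D"
    by (rule face_of_Int_supporting_hyperplane_le[OF polyhedron_imp_convex[OF poly] le])
  have vD: "v \<in> D" "w \<in> D" using v(1) w(1) by (auto simp: vertices_def extreme_point_of_def)
  have dec': "D = {a + b | a b. a \<in> convex hull {v. v extreme_point_of D} \<and>
      b \<in> {b. transpose W *v b \<le> 0}}"
    using dec by (simp add: vertices_def)
  show thesis
  proof (rule polyhedron_edge_in_face[OF poly dec' recession_cone_cone recession_cone_closed F, of v w])
    fix v' w'
    assume *: "v' \<in> ?F" "w' \<in> ?F" "v' extreme_point_of D" "w' extreme_point_of D"
      "closed_segment v' w' edge_of D"
    then have "adjacent D v' w'" by (simp add: adjacent_def vertices_def)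
    moreover have "v' \<bullet> t = w' \<bullet> t" using * by (simp add: inner_commute)
    ultimately show thesis by (rule that)
  qed (use vD v w in \<open>auto simp: vertices_def inner_commute\<close>)
qed

lemma inner_rhs:
  assumes "inj \<iota>"
  shows "v \<bullet> (rhs \<iota> hbar \<xi> - t) = (\<Sum>i\<in>UNIV. v $ \<iota> i * \<xi> $ i) + v \<bullet> (rhs \<iota> hbar 0 - t)"
proof -
  have "v \<bullet> (rhs \<iota> hbar \<xi> - rhs \<iota> hbar 0) = (\<Sum>j\<in>UNIV. if j \<in> range \<iota> then v $ j * \<xi> $ inv \<iota> j else 0)"
    by (auto simp: inner_vec_def rhs_def intro!: sum.cong)
  also have "\<dots> = (\<Sum>j\<in>range \<iota>. v $ j * \<xi> $ inv \<iota> j)" by (simp add: sum.If_cases)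
  also have "\<dots> = (\<Sum>i\<in>UNIV. v $ \<iota> i * \<xi> $ i)" using assms by (simp add: sum.reindex)
  finally show ?thesis by (simp add: inner_diff_right)
qed

theorem theorem5p1:
  fixes X :: "(real ^ 'm) set"
    and T :: "real ^ 'm ^ 'r"
    and W :: "real ^ 'n ^ 'r"
    and q :: "real ^ 'n"
    and \<iota> :: "'d::finite \<Rightarrow> 'r::finite"
    and hbar :: "real ^ 'r"
    and P :: "(real ^ 'd) measure"
    and \<rho> :: "'d \<Rightarrow> real \<Rightarrow> real"
    and k :: 'd
    and x :: "real ^ 'm"
  assumes X: "polyhedron X"
    and d_le_r: "inj \<iota>"
    and decomposition: "dual_feasible W q =
      {a + b | a b. a \<in> convex hull (vertices (dual_feasible W q)) \<and> transpose W *v b \<le> 0}"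
    and P: "prob_space P"
    and A1: "\<forall>\<xi>. \<forall>x\<in>X. rhs \<iota> hbar \<xi> - T *v x \<in> pos_image W"
    and A2: "dual_feasible W q \<noteq> {}"
    and A3: "integrable P (\<lambda>\<xi>. norm \<xi>)"
    and A4: "\<forall>i. continuous_prob_density (\<rho> i)"
      "P = density lborel (\<lambda>\<xi>. ennreal (\<Prod>i\<in>UNIV. \<rho> i (\<xi> $ i)))"
    and A5: "\<forall>v w. adjacent (dual_feasible W q) v w \<longrightarrow> (\<forall>i. v $ i \<noteq> w $ i)"
    and x: "x \<in> X"
  shows "continuously_differentiable (kth_projection \<rho> k (integrand W q T \<iota> hbar x)) \<and>
    (\<forall>s\<ge>2. C_real (s - 2) (\<rho> k) \<longrightarrow>
      cont_differentiable_ae s (kth_projection \<rho> k (integrand W q T \<iota> hbar x)))"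
proof -
  define D where "D = dual_feasible W q"
  define V where "V = vertices D"
  define m where "m v = v $ \<iota> k" for v :: "real ^ 'r"
  \<comment> \<open>The \<open>k\<close>th component is zero because the integration variable
    replaces \<open>\<xi> $ k\<close>; its coefficient is the slope \<open>m v\<close>.\<close>
  define b :: "real ^ 'r \<Rightarrow> real ^ 'd" where "b v = (\<chi> i. if i = k then 0 else v $ \<iota> i)" for v
  define d where "d v = v \<bullet> (rhs \<iota> hbar 0 - T *v x)" for v
  define pt where "pt \<eta> s = rhs \<iota> hbar (\<chi> i. if i = k then s else \<eta> $ i) - T *v x" for \<eta> :: "real ^ 'd" and s
  note dec = decomposition[folded D_def]
  have line: "v \<bullet> pt \<eta> s = m v * s + b v \<bullet> \<eta> + d v" for v \<eta> s
  proof -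
    have "(\<Sum>i\<in>UNIV. v $ \<iota> i * (\<chi> i. if i = k then s else \<eta> $ i) $ i) =
        (\<Sum>i\<in>UNIV. (if i = k then m v * s else 0) + b v $ i * \<eta> $ i)"
      by (intro sum.cong) (auto simp: b_def m_def)
    also have "\<dots> = m v * s + b v \<bullet> \<eta>" by (simp add: sum.distrib inner_vec_def)
    finally show ?thesis unfolding pt_def d_def by (subst inner_rhs[OF d_le_r]) simp
  qed
  have fin: "finite V"
    unfolding V_def vertices_def D_def by (intro finite_polyhedron_extreme_points dual_feasible_polyhedron)
  have ne: "V \<noteq> {}"
  proof
    assume "V = {}"
    then have "D = {}" using dec by (simp add: V_def)
    then show False using A2 by (simp add: D_def)
  qed
  have "line_envelope V m d b (\<rho> k)"
  proof
    show "continuous_prob_density (\<rho> k)" using A4 by blast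
    show "integrable lborel (\<lambda>s. s * \<rho> k s)"
      using integrable_first_moment[OF A4(1) A3[unfolded A4(2)]] .
    fix \<eta> :: "real ^ 'd"
    define S where "S = {(v, w) \<in> V \<times> V. m v \<noteq> m w}"
    \<comment> \<open>The values of \<open>s\<close> at which two lines of different slope cross. At
      any other \<open>s\<close> a tie for the maximum would produce tied adjacent vertices, whose
      slopes differ by the geometric condition.\<close>
    define B where "B = (\<lambda>(v, w). (b w \<bullet> \<eta> + d w - b v \<bullet> \<eta> - d v) / (m v - m w)) ` S"
    have "finite S" by (rule finite_subset[of _ "V \<times> V"]) (auto simp: S_def fin)
    then have "finite B" by (simp add: B_def)
    then have "AE s in lborel. s \<notin> B"
      by (intro AE_not_in finite_imp_null_set_lborel)
    then show "AE s in lborel. \<exists>v\<in>V. \<forall>w\<in>V - {v}. m w * s + b w \<bullet> \<eta> + d w < m v * s + b v \<bullet> \<eta> + d v"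
    proof eventually_elim
      case (elim s)
      \<comment> \<open>Relatively complete recourse bounds the dual problem at this right-hand
        side, as \<open>active_vertices_adjacent\<close> requires.\<close>
      have t: "pt \<eta> s \<in> pos_image W" unfolding pt_def using A1 x by blast
      obtain v where v: "v \<in> V" "\<And>u. u \<in> V \<Longrightarrow> u \<bullet> pt \<eta> s \<le> v \<bullet> pt \<eta> s"
        using arg_min_if_finite[OF fin ne, of "\<lambda>v. - (v \<bullet> pt \<eta> s)"] by (metis neg_le_iff_le not_le)
      have "w \<bullet> pt \<eta> s < v \<bullet> pt \<eta> s" if w: "w \<in> V - {v}" for w
      proof (rule ccontr)
        assume "\<not> w \<bullet> pt \<eta> s < v \<bullet> pt \<eta> s"
        then have eq: "w \<bullet> pt \<eta> s = v \<bullet> pt \<eta> s" using v(2)[of w] w by simp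
        obtain v' w' where vw: "adjacent D v' w'" "v' \<bullet> pt \<eta> s = w' \<bullet> pt \<eta> s"
          using active_vertices_adjacent[OF decomposition t, folded D_def V_def, OF v _ _ eq] w by blast
        have "m v' \<noteq> m w'" using A5 vw(1) by (simp add: m_def D_def)
        moreover have "v' \<in> V" "w' \<in> V" using vw(1) by (auto simp: V_def adjacent_def)
        moreover have "s = (b w' \<bullet> \<eta> + d w' - b v' \<bullet> \<eta> - d v') / (m v' - m w')"
          using vw(2) \<open>m v' \<noteq> m w'\<close> unfolding line by (simp add: field_simps)
        ultimately have "s \<in> B" unfolding B_def S_def by force
        then show False using elim by simp
      qed
      then show ?case using v(1) unfolding line by blast
    qed
  qed (use fin ne in auto)
  then interpret line_envelope V m d b "\<rho> k" .
  let ?F = "kth_projection \<rho> k (integrand W q T \<iota> hbar x)"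
  have F: "?F = mean_env"
  proof
    show "?F \<xi> = mean_env \<xi>" for \<xi>
      unfolding kth_projection_def mean_env_def env_def line_def integrand_def line[symmetric]
      by (simp only: pt_def V_def D_def)
  qed
  have cont: "continuous_on UNIV mean_env"
    by (intro continuous_at_imp_continuous_on ballI has_derivative_continuous[OF has_derivative_mean_env])
  have "continuously_differentiable ?F"
    unfolding continuously_differentiable_def F
  proof (intro exI[of _ "\<lambda>\<eta>. \<Sum>v\<in>V. weight v \<eta> *\<^sub>R blinfun_inner_left (b v)"] conjI allI)
    fix \<eta>
    show "(mean_env has_derivative blinfun_apply (\<Sum>v\<in>V. weight v \<eta> *\<^sub>R blinfun_inner_left (b v))) (at \<eta>)"
      by (rule has_derivative_eq_rhs[OF has_derivative_mean_env])
        (simp add: fun_eq_iff blinfun.sum_left blinfun.scaleR_left inner_commute)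
    show "continuous_on UNIV (\<lambda>\<eta>. \<Sum>v\<in>V. weight v \<eta> *\<^sub>R blinfun_inner_left (b v))"
      by (intro continuous_intros continuous_weight)
  qed
  moreover have "cont_differentiable_ae s ?F" if s: "s \<ge> 2" "C_real (s - 2) (\<rho> k)" for s
  proof -
    \<comment> \<open>Two orders are gained: \<open>\<rho> k\<close> has order \<open>n\<close>, its
      distribution function and the weights have \<open>n + 1\<close>, and \<open>mean_env\<close>
      has \<open>n + 2\<close>, as its partial derivatives are fixed linear combinations of the
      weights.\<close>
    define n where "n = s - 2"
    have sn: "s = Suc (Suc n)" using s(1) by (simp add: n_def)
    obtain N where N: "negligible N" "\<And>\<xi>. \<xi> \<notin> N \<Longrightarrow>
        \<exists>U. open U \<and> \<xi> \<in> U \<and> (\<forall>v\<in>V. smooth_on U (Suc n) (weight v))"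
      by (rule weight_locally_smooth[OF line_envelope_axioms s(2)[folded n_def]]) blast
    have "cont_differentiable_at s mean_env \<xi>" if \<xi>: "\<xi> \<notin> N" for \<xi>
    proof -
      obtain U where U: "open U" "\<xi> \<in> U" "\<And>v. v \<in> V \<Longrightarrow> smooth_on U (Suc n) (weight v)"
        using N(2)[OF \<xi>] by blast
      have "smooth_on U (Suc (Suc n)) mean_env"
      proof (rule smooth_on_SucI[OF U(1)])
        show "continuous_on U mean_env" by (rule continuous_on_subset[OF cont]) simp
        show "((\<lambda>t. mean_env (\<eta> + t *\<^sub>R axis i 1)) has_real_derivative
            (\<Sum>v\<in>V. b v $ i * weight v \<eta>)) (at 0)" for i \<eta>
        proof -
          have "((\<lambda>t. \<eta> + t *\<^sub>R axis i 1) has_derivative (\<lambda>t. t *\<^sub>R axis i 1)) (at (0 :: real))"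
            by (auto intro!: derivative_eq_intros)
          moreover have "(mean_env has_derivative (\<lambda>h. \<Sum>v\<in>V. weight v \<eta> * (b v \<bullet> h)))
              (at (\<eta> + 0 *\<^sub>R axis i 1))"
            using has_derivative_mean_env[of \<eta>] by simp
          ultimately have "((\<lambda>t. mean_env (\<eta> + t *\<^sub>R axis i 1)) has_derivative
              (\<lambda>t. \<Sum>v\<in>V. weight v \<eta> * (b v \<bullet> t *\<^sub>R axis i 1))) (at 0)"
            by (rule has_derivative_compose)
          then show ?thesis unfolding has_field_derivative_def
            by (rule has_derivative_eq_rhs)
              (simp add: fun_eq_iff inner_axis sum_distrib_right sum_distrib_left ac_simps)
        qed
        show "smooth_on U (Suc n) (\<lambda>\<eta>. \<Sum>v\<in>V. b v $ i * weight v \<eta>)" for i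
          by (intro smooth_on_sum smooth_on_cmult U)
      qed
      then show ?thesis unfolding sn by (rule smooth_on_imp_cont_differentiable_at[OF U(1,2)])
    qed
    moreover have "N \<in> null_sets lebesgue" using N(1) by (simp add: negligible_iff_null_sets)
    ultimately show ?thesis unfolding cont_differentiable_ae_def F by blast
  qed
  ultimately show ?thesis by blast
qed

end
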